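(* Let $Y$ be a rational representation of $\mathrm{GL}(V)\times\mathrm{GL}(W)$ and let $F:\wedge^2V\otimes W\to Y$ be a covariant. Then $f=F\circ u$ takes values in $Y^{H_5}$ and is a discrete covariant for the representation of $\Gamma=\mathrm{SL}_2(\mathbb{Z}/5\mathbb{Z})$ on $Y^{H_5}$, i.e. $f\circ\chi_1(\gamma)=\theta_Y(1,\gamma)\circ f$ for all $\gamma\in\Gamma$. Moreover $F$ is uniquely determined by $f$ (any two covariants $\wedge^2V\otimes W\to Y$ with the same restriction $F\circ u$ are equal).
   Context: $K$ is an algebraically closed field of characteristic not $2,3,5$, and $\zeta_5\in K$ a primitive $5$th root of unity. $V,W$ are $5$-dimensional with bases $v_0,\dots,v_4$ and $w_0,\dots,w_4$. A covariant for a rational representation $\rho_Y$ of $\mathrm{GL}(V)\times\mathrm{GL}(W)$ on $Y$ is a polynomial map $F:\wedge^2V\otimes W\to Y$ with $F\circ g=\rho_Y(g)\circ F$ for all $g\in\mathrm{SL}(V)\times\mathrm{SL}(W)$. The Hesse family is $u:\mathbb{A}^2\to\wedge^2V\otimes W$, $u(a,b)=a\sum(v_1\wedge v_4)w_0+b\sum(v_2\wedge v_3)w_0$, sums over the five cyclic permutations of subscripts mod 5. Let $H_5=\langle\sigma,\tau\mid\sigma^5=\tau^5=[\sigma,[\sigma,\tau]]=[\tau,[\sigma,\tau]]=1\rangle$, $\zeta=[\sigma,\tau]$, and $H_5^+=H_5\ltimes\mathrm{SL}_2(\mathbb{Z}/5\mathbb{Z})$ with law $(h,\gamma)(h',\gamma')=(h\,s_\beta(\gamma)h',\gamma\gamma')$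 where $s_\beta\begin{pmatrix}a&b\\c&d\end{pmatrix}:\sigma\mapsto\zeta^{-ac/2}\sigma^a\tau^c,\ \tau\mapsto\zeta^{-bd/2}\sigma^b\tau^d$. The representations $\theta_V:H_5\to\mathrm{SL}(V)$, $\sigma:v_i\mapsto\zeta_5^{2i}v_i$, $\tau:v_i\mapsto v_{i+1}$ and $\theta_W:H_5\to\mathrm{SL}(W)$, $\sigma:w_i\mapsto\zeta_5^iw_i$, $\tau:w_i\mapsto w_{i+1}$ each extend uniquely to representations of $H_5^+$, still denoted $\theta_V,\theta_W$. For a rational representation $Y$, $(\theta_V,\theta_W)$ gives an action $\theta_Y$ of $H_5^+$ on $Y$; $Y^{H_5}$ denotes the subspace fixed by $H_5$, on which $\Gamma=\mathrm{SL}_2(\mathbb{Z}/5\mathbb{Z})$ acts by $\gamma\mapsto\theta_Y(1,\gamma)$. The image of $u$ equals $(\wedge^2V\otimes W)^{H_5}$, and $\chi_1:\Gamma\to\mathrm{GL}_2(K)$ is defined by $u\circ\chi_1(\gamma)=\theta_{\wedge^2V\otimes W}(1,\gamma)\circ u$. For a representation $\pi:\Gamma\to\mathrm{GL}(Z)$, a discrete covariant is a polynomial map $f:\mathbb{A}^2\to Z$ with $f\circ\chi_1(\gamma)=\pi(\gamma)\circ f$ for all $\gamma\in\Gamma$. *)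

theory Defs
  imports
    "HOL-Analysis.Analysis"
    "HOL-Algebra.Group"
    "HOL-Computational_Algebra.Polynomial"
begin

section \<open>Linear groups and residues modulo 5\<close>

text \<open>
  \<^item> The spaces \<open>V\<close> and \<open>W\<close> are both \<open>'k^5\<close>.  The index type \<open>5\<close> is the ring \<open>\<int>/5\<int>\<close>, so subscripts
    are read modulo 5, and \<open>v\<^sub>i\<close> (resp. \<open>w\<^sub>i\<close>) is \<open>axis i 1\<close>.
  \<^item> \<open>GL(V)\<close> and \<open>GL(W)\<close> are \<open>GL :: ('k^5^5) monoid\<close>.
  \<^item> \<open>SL\<^sub>2(\<int>/5\<int>)\<close> is \<open>SL :: (5^2^2) monoid\<close>.
\<close>

definition GL :: "('r::comm_ring_1 ^ 'n ^ 'n) monoid"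
  where "GL = \<lparr>carrier = {A. invertible A}, monoid.mult = (**), one = mat 1\<rparr>"

definition SL :: "('r::comm_ring_1 ^ 'n ^ 'n) monoid"
  where "SL = \<lparr>carrier = {A. det A = 1}, monoid.mult = (**), one = mat 1\<rparr>"

text \<open>The representative of a residue class modulo 5 among \<open>0, \<dots>, 4\<close>.\<close>

definition res5 :: "5 \<Rightarrow> nat"
  where "res5 a = (LEAST n. of_nat n = a)"


section \<open>The group \<open>H\<^sub>5\<close> given by generators and relations\<close>

datatype h5_gen = Sig | Tau

text \<open>The letter \<open>(x, True)\<close> stands for \<open>x\<close> and \<open>(x, False)\<close> for the inverse of \<open>x\<close>.\<close>

type_synonym h5_word = "(h5_gen \<times> bool) list"

definition inv_word :: "h5_word \<Rightarrow> h5_word"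
  where "inv_word w = rev (map (\<lambda>(x, e). (x, \<not> e)) w)"

text \<open>
  The commutator is \<open>[v, w] = v w v\<^sup>-\<^sup>1 w\<^sup>-\<^sup>1\<close>.  With \<open>v\<^sup>-\<^sup>1 w\<^sup>-\<^sup>1 v w\<close> instead, the relations below define
  the same group and the same element \<open>\<zeta>\<close>, since \<open>[\<sigma>, \<tau>]\<close> is central.
\<close>

definition comm_word :: "h5_word \<Rightarrow> h5_word \<Rightarrow> h5_word"
  where "comm_word v w = v @ w @ inv_word v @ inv_word w"

definition h5_relators :: "h5_word set"
  where "h5_relators =
    {replicate 5 (Sig, True), replicate 5 (Tau, True),
     comm_word [(Sig, True)] (comm_word [(Sig, True)] [(Tau, True)]),
     comm_word [(Tau, True)] (comm_word [(Sig, True)] [(Tau, True)])}"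

inductive h5_eq :: "h5_word \<Rightarrow> h5_word \<Rightarrow> bool"
  where
    h5_eq_refl: "h5_eq w w"
  | h5_eq_sym: "h5_eq v w \<Longrightarrow> h5_eq w v"
  | h5_eq_trans: "h5_eq u v \<Longrightarrow> h5_eq v w \<Longrightarrow> h5_eq u w"
  | h5_eq_append: "h5_eq v v' \<Longrightarrow> h5_eq w w' \<Longrightarrow> h5_eq (v @ w) (v' @ w')"
  | h5_eq_cancel: "h5_eq [(x, e), (x, \<not> e)] []"
  | h5_eq_relator: "r \<in> h5_relators \<Longrightarrow> h5_eq r []"

quotient_type h5 = h5_word / h5_eq
  by (rule equivpI)
    (auto simp: reflp_def symp_def transp_def intro: h5_eq_refl h5_eq_sym h5_eq_trans)

lemma inv_word_append: "inv_word (v @ w) = inv_word w @ inv_word v"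
  by (simp add: inv_word_def)

lemma inv_word_inv_word [simp]: "inv_word (inv_word w) = w"
  by (simp add: inv_word_def rev_map[symmetric] o_def case_prod_unfold)

lemma h5_eq_inv_left: "h5_eq (inv_word w @ w) []"
proof (induction w)
  case Nil
  then show ?case by (simp add: inv_word_def h5_eq_refl)
next
  case (Cons l w)
  obtain x e where l: "l = (x, e)" by (cases l)
  have "h5_eq [(x, \<not> e), (x, \<not> \<not> e)] []" by (rule h5_eq_cancel)
  then have "h5_eq (inv_word w @ ([(x, \<not> e), (x, e)] @ w)) (inv_word w @ ([] @ w))"
    by (intro h5_eq_append h5_eq_refl) simp
  then have "h5_eq (inv_word w @ [(x, \<not> e), (x, e)] @ w) []"
    using Cons.IH by (auto intro: h5_eq_trans)
  then show ?case by (simp add: inv_word_def l)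
qed

lemma h5_eq_inv_word:
  assumes "h5_eq v w" shows "h5_eq (inv_word v) (inv_word w)"
proof -
  have vw: "h5_eq (v @ inv_word w) []"
  proof -
    have "h5_eq (v @ inv_word w) (w @ inv_word w)"
      using assms by (intro h5_eq_append h5_eq_refl)
    then show ?thesis
      using h5_eq_inv_left[of "inv_word w"] by (auto intro: h5_eq_trans)
  qed
  have "h5_eq (inv_word v @ (v @ inv_word w)) (inv_word v @ [])"
    using vw by (intro h5_eq_append h5_eq_refl)
  moreover have "h5_eq ((inv_word v @ v) @ inv_word w) ([] @ inv_word w)"
    using h5_eq_inv_left by (intro h5_eq_append h5_eq_refl)
  ultimately show ?thesis
    by simp (blast intro: h5_eq_trans h5_eq_sym)
qed

instantiation h5 :: "{monoid_mult, inverse}"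
begin

lift_definition one_h5 :: h5 is "[]" .

lift_definition times_h5 :: "h5 \<Rightarrow> h5 \<Rightarrow> h5" is "(@)"
  by (rule h5_eq_append)

lift_definition inverse_h5 :: "h5 \<Rightarrow> h5" is inv_word
  by (rule h5_eq_inv_word)

definition divide_h5 :: "h5 \<Rightarrow> h5 \<Rightarrow> h5"
  where "divide_h5 g h = g * inverse h"

instance
  by standard (transfer; simp add: h5_eq_refl)+

end

lemma h5_left_inverse [simp]: "inverse g * g = (1::h5)"
  by transfer (rule h5_eq_inv_left)

lemma h5_right_inverse [simp]: "g * inverse g = (1::h5)"
  by transfer (metis h5_eq_inv_left inv_word_inv_word)

lift_definition \<sigma> :: h5 is "[(Sig, True)]" .
lift_definition \<tau> :: h5 is "[(Tau, True)]" .

definition comm :: "h5 \<Rightarrow> h5 \<Rightarrow> h5"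
  where "comm g h = g * h * inverse g * inverse h"

definition \<zeta> :: h5
  where "\<zeta> = comm \<sigma> \<tau>"

lemma h5_relations:
  "\<sigma> ^ 5 = 1" "\<tau> ^ 5 = 1" "comm \<sigma> \<zeta> = 1" "comm \<tau> \<zeta> = 1"
proof -
  have "\<sigma> * \<sigma> * \<sigma> * \<sigma> * \<sigma> = 1"
    by transfer (rule h5_eq_relator, simp add: h5_relators_def eval_nat_numeral)
  then show "\<sigma> ^ 5 = 1"
    by (simp add: eval_nat_numeral mult.assoc)
  have "\<tau> * \<tau> * \<tau> * \<tau> * \<tau> = 1"
    by transfer (rule h5_eq_relator, simp add: h5_relators_def eval_nat_numeral)
  then show "\<tau> ^ 5 = 1"
    by (simp add: eval_nat_numeral mult.assoc)
  show "comm \<sigma> \<zeta> = 1"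
    unfolding \<zeta>_def comm_def
    by transfer (rule h5_eq_relator, simp add: h5_relators_def comm_word_def)
  show "comm \<tau> \<zeta> = 1"
    unfolding \<zeta>_def comm_def
    by transfer (rule h5_eq_relator, simp add: h5_relators_def comm_word_def)
qed

lemma h5_comm_eq_1_iff: "comm g h = 1 \<longleftrightarrow> g * h = h * g"
proof
  assume "comm g h = 1"
  then have "comm g h * (h * g) = h * g" by simp
  moreover have "comm g h * (h * g) = g * h * (inverse g * ((inverse h * h) * g))"
    unfolding comm_def by (simp only: mult.assoc)
  ultimately show "g * h = h * g" by simp
next
  assume "g * h = h * g"
  then have "comm g h = h * (g * inverse g) * inverse h"
    unfolding comm_def by (simp only: mult.assoc)
  then show "comm g h = 1" by simp
qed


section \<open>The action of \<open>SL\<^sub>2(\<int>/5\<int>)\<close> on \<open>H\<^sub>5\<close>\<close>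

primrec h5_letter :: "h5 \<Rightarrow> h5 \<Rightarrow> h5_gen \<Rightarrow> h5"
  where
    "h5_letter s t Sig = s"
  | "h5_letter s t Tau = t"

text \<open>Substitute \<open>s\<close> for \<open>\<sigma>\<close> and \<open>t\<close> for \<open>\<tau>\<close> in a word.\<close>

definition h5_subst :: "h5 \<Rightarrow> h5 \<Rightarrow> h5_word \<Rightarrow> h5"
  where "h5_subst s t w =
    prod_list (map (\<lambda>(x, e). if e then h5_letter s t x else inverse (h5_letter s t x)) w)"

lemma h5_subst_append: "h5_subst s t (v @ w) = h5_subst s t v * h5_subst s t w"
  by (simp add: h5_subst_def)

lemma h5_inverse_unique: "g * h = (1::h5) \<Longrightarrow> h = inverse g"
  by (metis h5_left_inverse mult.assoc mult_1_left mult_1_right)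

lemma h5_subst_inv_word: "h5_subst s t (inv_word w) = inverse (h5_subst s t w)"
proof (rule h5_inverse_unique)
  show "h5_subst s t w * h5_subst s t (inv_word w) = 1"
  proof (induction w)
    case Nil
    then show ?case by (simp add: h5_subst_def inv_word_def)
  next
    case (Cons l w)
    have *: "h5_subst s t [l] * h5_subst s t (inv_word [l]) = 1"
      by (cases l) (simp add: h5_subst_def inv_word_def)
    have "h5_subst s t (l # w) * h5_subst s t (inv_word (l # w)) =
        h5_subst s t [l] * (h5_subst s t w * h5_subst s t (inv_word w)) * h5_subst s t (inv_word [l])"
      using h5_subst_append[of s t "[l]" w] inv_word_append[of "[l]" w]
      by (simp add: h5_subst_append mult.assoc)
    then show ?case using Cons.IH * by simp
  qed
qed

lemma h5_subst_cong:
  assumes "h5_eq v w"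
    and rels: "s ^ 5 = 1" "t ^ 5 = 1" "comm s (comm s t) = 1" "comm t (comm s t) = 1"
  shows "h5_subst s t v = h5_subst s t w"
  using assms(1)
proof induction
  case (h5_eq_cancel x e)
  then show ?case by (cases e) (simp_all add: h5_subst_def)
next
  case (h5_eq_relator r)
  have comm: "h5_subst s t (comm_word v w) = comm (h5_subst s t v) (h5_subst s t w)" for v w
    by (simp add: comm_word_def comm_def h5_subst_append h5_subst_inv_word mult.assoc)
  have one: "h5_subst s t [(Sig, True)] = s" "h5_subst s t [(Tau, True)] = t"
    by (simp_all add: h5_subst_def)
  have five: "h5_subst s t (replicate 5 (x, True)) = h5_letter s t x ^ 5" for x
    by (simp add: h5_subst_def eval_nat_numeral mult.assoc)
  have "h5_subst s t r = 1"
    using h5_eq_relator rels by (auto simp: h5_relators_def comm one five)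
  then show ?case by (simp add: h5_subst_def)
qed (simp_all add: h5_subst_append)

lemma \<zeta>_commutes: "\<zeta> * \<sigma> = \<sigma> * \<zeta>" "\<zeta> * \<tau> = \<tau> * \<zeta>"
  using h5_relations(3,4) by (simp_all add: h5_comm_eq_1_iff)

lemma \<sigma>_\<tau>: "\<sigma> * \<tau> = \<zeta> * \<tau> * \<sigma>"
proof -
  have "\<zeta> * \<tau> * \<sigma> = \<sigma> * \<tau> * (inverse \<sigma> * ((inverse \<tau> * \<tau>) * \<sigma>))"
    unfolding \<zeta>_def comm_def by (simp only: mult.assoc)
  then show ?thesis by simp
qed

lemma \<zeta>_pow_commutes: "\<zeta> ^ k * \<sigma> ^ a = \<sigma> ^ a * \<zeta> ^ k" "\<zeta> ^ k * \<tau> ^ a = \<tau> ^ a * \<zeta> ^ k"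
  using \<zeta>_commutes by (metis power_commuting_commutes)+

lemma \<sigma>_pow_\<tau>: "\<sigma> ^ a * \<tau> = \<zeta> ^ a * \<tau> * \<sigma> ^ a"
proof (induction a)
  case (Suc a)
  have "\<sigma> ^ Suc a * \<tau> = \<sigma> * (\<sigma> ^ a * \<tau>)" by (simp add: mult.assoc)
  also have "\<dots> = (\<sigma> * \<zeta> ^ a) * \<tau> * \<sigma> ^ a" unfolding Suc.IH by (simp only: mult.assoc)
  also have "\<dots> = \<zeta> ^ a * (\<sigma> * \<tau>) * \<sigma> ^ a"
    using \<zeta>_pow_commutes(1)[of a 1] by (simp add: mult.assoc[symmetric])
  also have "\<dots> = (\<zeta> ^ a * \<zeta>) * \<tau> * (\<sigma> * \<sigma> ^ a)" unfolding \<sigma>_\<tau> by (simp only: mult.assoc)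
  finally show ?case by (simp add: power_commutes)
qed simp

lemma \<zeta>_pow_5: "\<zeta> ^ 5 = 1"
proof -
  have "\<tau> = \<zeta> ^ 5 * \<tau>" using \<sigma>_pow_\<tau>[of 5] by (simp add: h5_relations)
  then have "\<tau> * inverse \<tau> = \<zeta> ^ 5 * (\<tau> * inverse \<tau>)" by (metis mult.assoc)
  then show ?thesis by simp
qed

lemma \<sigma>_pow_\<tau>_pow: "\<sigma> ^ a * \<tau> ^ c = \<zeta> ^ (a * c) * \<tau> ^ c * \<sigma> ^ a"
proof (induction c)
  case (Suc c)
  have "\<sigma> ^ a * \<tau> ^ Suc c = (\<sigma> ^ a * \<tau>) * \<tau> ^ c" by (simp add: mult.assoc)
  also have "\<dots> = \<zeta> ^ a * \<tau> * (\<sigma> ^ a * \<tau> ^ c)" unfolding \<sigma>_pow_\<tau> by (simp only: mult.assoc)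
  also have "\<dots> = \<zeta> ^ a * (\<tau> * \<zeta> ^ (a * c)) * \<tau> ^ c * \<sigma> ^ a"
    unfolding Suc.IH by (simp only: mult.assoc)
  also have "\<tau> * \<zeta> ^ (a * c) = \<zeta> ^ (a * c) * \<tau>"
    using \<zeta>_pow_commutes(2)[of "a * c" 1] by simp
  finally show ?case by (simp add: power_add mult.assoc)
qed simp

text \<open>Multiplication of normal forms; note \<open>4 = -1\<close> modulo 5.\<close>

lemma h5_normal_mult:
  "(\<zeta> ^ k * \<sigma> ^ a * \<tau> ^ c) * (\<zeta> ^ l * \<sigma> ^ b * \<tau> ^ d) =
    \<zeta> ^ (k + l + 4 * b * c) * \<sigma> ^ (a + b) * \<tau> ^ (c + d)"
proof -
  have z5: "\<zeta> ^ (5 * m) = 1" for m by (simp add: power_mult \<zeta>_pow_5)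
  have "\<zeta> ^ (4 * b * c) * (\<sigma> ^ b * \<tau> ^ c) = \<zeta> ^ (5 * (b * c)) * (\<tau> ^ c * \<sigma> ^ b)"
    unfolding \<sigma>_pow_\<tau>_pow by (simp add: mult.assoc[symmetric] power_add[symmetric])
  then have swap: "\<tau> ^ c * \<sigma> ^ b = \<zeta> ^ (4 * b * c) * \<sigma> ^ b * \<tau> ^ c"
    using z5 by (simp add: mult.assoc)
  have com: "x * \<zeta> ^ m = \<zeta> ^ m * x \<Longrightarrow> x * (\<zeta> ^ m * y) = \<zeta> ^ m * (x * y)" for x y m
    by (metis mult.assoc)
  note coms = com[OF \<zeta>_pow_commutes(1)[symmetric]] com[OF \<zeta>_pow_commutes(2)[symmetric]]
  have "(\<zeta> ^ k * \<sigma> ^ a * \<tau> ^ c) * (\<zeta> ^ l * \<sigma> ^ b * \<tau> ^ d) =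
      \<zeta> ^ k * (\<zeta> ^ l * (\<sigma> ^ a * ((\<tau> ^ c * \<sigma> ^ b) * \<tau> ^ d)))"
    by (simp add: mult.assoc coms)
  also have "\<dots> = \<zeta> ^ k * (\<zeta> ^ l * (\<zeta> ^ (4 * b * c) * (\<sigma> ^ a * (\<sigma> ^ b * (\<tau> ^ c * \<tau> ^ d)))))"
    unfolding swap by (simp add: mult.assoc coms)
  finally show ?thesis by (simp add: power_add mult.assoc)
qed

lemma h5_normal_relations:
  fixes k a c l b d :: nat
  defines "s \<equiv> \<zeta> ^ k * \<sigma> ^ a * \<tau> ^ c" and "t \<equiv> \<zeta> ^ l * \<sigma> ^ b * \<tau> ^ d"
  shows "s ^ 5 = 1" "t ^ 5 = 1" "comm s t = \<zeta> ^ (a * d + 4 * b * c)"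
    "comm s (comm s t) = 1" "comm t (comm s t) = 1"
proof -
  have p5: "\<zeta> ^ (5 * m) = 1" "\<sigma> ^ (5 * m) = 1" "\<tau> ^ (5 * m) = 1" for m
    by (simp_all add: power_mult \<zeta>_pow_5 h5_relations)
  have pow: "(\<zeta> ^ k * \<sigma> ^ a * \<tau> ^ c) ^ 5 = 1" for k a c
  proof -
    have "(\<zeta> ^ k * \<sigma> ^ a * \<tau> ^ c) ^ 5 =
        \<zeta> ^ (5 * (k + 8 * (a * c))) * \<sigma> ^ (5 * a) * \<tau> ^ (5 * c)"
    proof -
      let ?x = "\<zeta> ^ k * \<sigma> ^ a * \<tau> ^ c"
      have "?x ^ 5 = ?x * (?x * (?x * (?x * ?x)))" by (simp add: eval_nat_numeral mult.assoc)
      also have "\<dots> = \<zeta> ^ (5 * (k + 8 * (a * c))) * \<sigma> ^ (5 * a) * \<tau> ^ (5 * c)"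
        unfolding h5_normal_mult
        by (intro arg_cong2[of _ _ _ _ "(*)"] arg_cong2[of _ _ _ _ "(^)"] refl) (simp_all add: algebra_simps)
      finally show ?thesis .
    qed
    then show ?thesis by (simp only: p5 mult_1_left)
  qed
  show "s ^ 5 = 1" "t ^ 5 = 1" unfolding s_def t_def by (rule pow)+
  let ?m = "a * d + 4 * b * c"
  have "t * s = \<zeta> ^ (l + k + 4 * a * d) * \<sigma> ^ (b + a) * \<tau> ^ (d + c)"
    unfolding s_def t_def by (rule h5_normal_mult)
  then have "\<zeta> ^ ?m * (t * s) = \<zeta> ^ (?m + (l + k + 4 * a * d)) * \<sigma> ^ (b + a) * \<tau> ^ (d + c)"
    by (simp only: power_add mult.assoc)
  also have "?m + (l + k + 4 * a * d) = 5 * (a * d) + (k + l + 4 * b * c)" by simp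
  also have "\<zeta> ^ \<dots> = \<zeta> ^ (k + l + 4 * b * c)" by (subst power_add) (simp only: p5 mult_1_left)
  also have "\<dots> * \<sigma> ^ (b + a) * \<tau> ^ (d + c) = s * t"
    unfolding s_def t_def h5_normal_mult by (simp add: add.commute)
  finally have st: "s * t = \<zeta> ^ ?m * (t * s)" ..
  have "comm s t = \<zeta> ^ ?m * (t * ((s * inverse s) * inverse t))"
    unfolding comm_def st by (simp only: mult.assoc)
  then show c: "comm s t = \<zeta> ^ ?m" by simp
  have cen: "(\<zeta> ^ k * \<sigma> ^ a * \<tau> ^ c) * \<zeta> ^ n = \<zeta> ^ n * (\<zeta> ^ k * \<sigma> ^ a * \<tau> ^ c)" for k a c n
    using h5_normal_mult[of k a c n 0 0] h5_normal_mult[of n 0 0 k a c]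
    by (simp add: add.commute)
  show "comm s (comm s t) = 1" "comm t (comm s t) = 1"
    unfolding c h5_comm_eq_1_iff unfolding s_def t_def by (rule cen)+
qed

text \<open>The element \<open>\<zeta>\<^bsup>-ac/2\<^esup> \<sigma>\<^sup>a \<tau>\<^sup>c\<close>; in \<open>\<int>/5\<int>\<close> the inverse of 2 is 3.\<close>

definition h5_heis :: "5 \<Rightarrow> 5 \<Rightarrow> h5"
  where "h5_heis a c = \<zeta> ^ res5 (- (3 * a * c)) * \<sigma> ^ res5 a * \<tau> ^ res5 c"

text \<open>For \<open>\<gamma> = (a b; c d)\<close> the endomorphism with \<open>\<sigma> \<mapsto> \<zeta>\<^bsup>-ac/2\<^esup> \<sigma>\<^sup>a \<tau>\<^sup>c\<close> and
  \<open>\<tau> \<mapsto> \<zeta>\<^bsup>-bd/2\<^esup> \<sigma>\<^sup>b \<tau>\<^sup>d\<close>.\<close>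

lift_definition s_beta :: "5^2^2 \<Rightarrow> h5 \<Rightarrow> h5"
  is "\<lambda>\<gamma>. h5_subst (h5_heis (\<gamma>$1$1) (\<gamma>$2$1)) (h5_heis (\<gamma>$1$2) (\<gamma>$2$2))"
  unfolding h5_heis_def by (erule h5_subst_cong) (rule h5_normal_relations)+

lemma s_beta_simps [simp]:
  "s_beta \<gamma> (g * h) = s_beta \<gamma> g * s_beta \<gamma> h"
  "s_beta \<gamma> 1 = 1"
  "s_beta \<gamma> \<sigma> = h5_heis (\<gamma>$1$1) (\<gamma>$2$1)"
  "s_beta \<gamma> \<tau> = h5_heis (\<gamma>$1$2) (\<gamma>$2$2)"
proof -
  show "s_beta \<gamma> (g * h) = s_beta \<gamma> g * s_beta \<gamma> h"
    by transfer (rule h5_subst_append)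
  show "s_beta \<gamma> 1 = 1" by transfer (simp add: h5_subst_def)
  show "s_beta \<gamma> \<sigma> = h5_heis (\<gamma>$1$1) (\<gamma>$2$1)" by transfer (simp add: h5_subst_def)
  show "s_beta \<gamma> \<tau> = h5_heis (\<gamma>$1$2) (\<gamma>$2$2)" by transfer (simp add: h5_subst_def)
qed

lemma s_beta_power: "s_beta \<gamma> (h ^ n) = s_beta \<gamma> h ^ n"
  by (induction n) simp_all

lemma s_beta_inverse: "s_beta \<gamma> (inverse h) = inverse (s_beta \<gamma> h)"
  by (rule h5_inverse_unique) (metis h5_right_inverse s_beta_simps(1,2))

lemma h5_induct:
  assumes "P 1" "\<And>h. P h \<Longrightarrow> P (\<sigma> * h)" "\<And>h. P h \<Longrightarrow> P (\<tau> * h)"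
  shows "P h"
proof -
  have pow: "P h \<Longrightarrow> P (\<sigma> ^ n * h)" "P h \<Longrightarrow> P (\<tau> ^ n * h)" for n h
    using assms(2,3) by (induction n) (simp_all add: mult.assoc)
  have inv: "inverse \<sigma> = \<sigma> ^ 4" "inverse \<tau> = \<tau> ^ 4"
    using h5_inverse_unique[of \<sigma> "\<sigma> ^ 4"] h5_inverse_unique[of \<tau> "\<tau> ^ 4"] h5_relations(1,2)
    by (simp_all add: eval_nat_numeral)
  have "P (abs_h5 w)" for w
  proof (induction w)
    case Nil
    then show ?case using assms(1) by (simp add: one_h5_def)
  next
    case (Cons l w)
    obtain x e where l: "l = (x, e)" by (cases l)
    have "abs_h5 (l # w) = abs_h5 [l] * abs_h5 w" by (simp add: times_h5.abs_eq)
    moreover have "abs_h5 [l] \<in> {\<sigma>, \<tau>, inverse \<sigma>, inverse \<tau>}"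
      unfolding \<sigma>_def \<tau>_def l
      by (cases x; cases e) (simp_all add: inverse_h5.abs_eq inv_word_def)
    ultimately show ?case using assms(2,3) pow Cons.IH by (auto simp: inv)
  qed
  then show ?thesis by (metis Quotient3_abs_rep Quotient3_h5)
qed

lemma of_nat_res5 [simp]: "of_nat (res5 a) = a"
proof -
  have "\<exists>n. of_nat n = a"
  proof (cases a)
    case (of_int z)
    then show ?thesis by (metis int_nat_eq of_int_of_nat_eq)
  qed
  then show ?thesis unfolding res5_def by (rule LeastI_ex)
qed

lemma power_cong_5:
  assumes "x ^ 5 = (1 :: 'a::monoid_mult)" "of_nat m = (of_nat n :: 5)"
  shows "x ^ m = x ^ n"
proof -
  have "x ^ m = x ^ n" if "m < n" "of_nat m = (of_nat n :: 5)" for m n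
  proof -
    have "5 dvd n - m" using that of_nat_eq_iff_char_dvd[of m n, where 'a = 5] by simp
    then obtain q where "n - m = 5 * q" by blast
    then have "n = m + 5 * q" using that(1) by simp
    then show ?thesis using assms(1) by (simp add: power_add power_mult)
  qed
  then show ?thesis using assms(2) by (cases m n rule: linorder_cases) metis+
qed

lemma h5_normal_cong:
  assumes "of_nat k = (of_nat k' :: 5)" "of_nat a = (of_nat a' :: 5)" "of_nat c = (of_nat c' :: 5)"
  shows "\<zeta> ^ k * \<sigma> ^ a * \<tau> ^ c = \<zeta> ^ k' * \<sigma> ^ a' * \<tau> ^ c'"
  using power_cong_5[OF \<zeta>_pow_5 assms(1)] power_cong_5[OF h5_relations(1) assms(2)]
    power_cong_5[OF h5_relations(2) assms(3)] by simp

lemma ring5: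
  fixes a b c d x y z w :: "'a::comm_ring_1"
  shows "- (3 * a * c) - 3 * b * d + 4 * b * c =
      3 * (a * d - c * b) - 3 * (a + b) * (c + d) + 10 * (b * c)"
    and "a * d + 4 * b * c = (a * d - b * c) + 5 * (b * c)"
    and "- (3 * a * c) + 3 * (a * x * (c * w) - a * z * (c * y)) =
      3 * a * c * ((x * w - y * z) - 1)"
  by (simp_all add: algebra_simps)

lemma h5_heis_mult:
  "h5_heis a c * h5_heis b d = \<zeta> ^ res5 (3 * (a * d - c * b)) * h5_heis (a + b) (c + d)"
proof -
  have "\<zeta> ^ n * (\<zeta> ^ k * \<sigma> ^ a * \<tau> ^ c) = \<zeta> ^ (n + k) * \<sigma> ^ a * \<tau> ^ c" for n k a c
    by (simp add: power_add mult.assoc)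
  note * = this
  have "(10 :: 5) = 0" by simp
  then have **: "- (3 * a * c) - 3 * b * d + 4 * b * c =
      3 * (a * d - c * b) - 3 * (a + b) * (c + d)"
    unfolding ring5(1) by (simp only: mult_zero_left add_0_right)
  show ?thesis
    unfolding h5_heis_def h5_normal_mult *
    by (rule h5_normal_cong) (use ** in \<open>simp_all add: mult.assoc\<close>)
qed

lemma h5_heis_0: "h5_heis 0 0 = 1"
  using h5_normal_cong[of "res5 0" 0 "res5 0" 0 "res5 0" 0] by (simp add: h5_heis_def)

lemma h5_heis_power: "h5_heis a c ^ n = h5_heis (of_nat n * a) (of_nat n * c)"
proof (induction n)
  case (Suc n)
  have "\<zeta> ^ res5 0 = 1" using power_cong_5[OF \<zeta>_pow_5, of "res5 0" 0] by simp
  then show ?case by (simp add: Suc h5_heis_mult algebra_simps)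
qed (simp add: h5_heis_0)

lemma s_beta_\<zeta>: assumes "det \<gamma> = 1" shows "s_beta \<gamma> \<zeta> = \<zeta>"
proof -
  let ?e = "res5 (\<gamma>$1$1) * res5 (\<gamma>$2$2) + 4 * res5 (\<gamma>$1$2) * res5 (\<gamma>$2$1)"
  have "s_beta \<gamma> \<zeta> = comm (h5_heis (\<gamma>$1$1) (\<gamma>$2$1)) (h5_heis (\<gamma>$1$2) (\<gamma>$2$2))"
    by (simp add: \<zeta>_def comm_def s_beta_inverse)
  also have "\<dots> = \<zeta> ^ ?e"
    unfolding h5_heis_def by (rule h5_normal_relations)
  also have "\<dots> = \<zeta> ^ 1"
  proof (rule power_cong_5[OF \<zeta>_pow_5])
    have "(5 :: 5) = 0" by simp
    moreover have "\<gamma>$1$1 * \<gamma>$2$2 - \<gamma>$1$2 * \<gamma>$2$1 = 1" using assms by (simp add: det_2)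
    moreover have "\<gamma>$1$1 * \<gamma>$2$2 + 4 * \<gamma>$1$2 * \<gamma>$2$1 =
        (\<gamma>$1$1 * \<gamma>$2$2 - \<gamma>$1$2 * \<gamma>$2$1) + 5 * (\<gamma>$1$2 * \<gamma>$2$1)"
      by (rule ring5)
    ultimately have "\<gamma>$1$1 * \<gamma>$2$2 + 4 * \<gamma>$1$2 * \<gamma>$2$1 = 1"
      by (simp only: mult_zero_left add_0_right)
    then show "of_nat ?e = (of_nat 1 :: 5)" by simp
  qed
  finally show ?thesis by simp
qed

lemma s_beta_heis:
  assumes "det \<gamma> = 1"
  shows "s_beta \<gamma> (h5_heis a c) = h5_heis (\<gamma>$1$1 * a + \<gamma>$1$2 * c) (\<gamma>$2$1 * a + \<gamma>$2$2 * c)"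
proof -
  let ?a = "\<gamma>$1$1" and ?b = "\<gamma>$1$2" and ?c = "\<gamma>$2$1" and ?d = "\<gamma>$2$2"
  have det: "?a * ?d - ?b * ?c = 1" using assms by (simp add: det_2)
  have "s_beta \<gamma> (h5_heis a c) =
      \<zeta> ^ res5 (- (3 * a * c)) * (h5_heis (a * ?a) (a * ?c) * h5_heis (c * ?b) (c * ?d))"
    unfolding h5_heis_def[of a c]
    by (simp add: s_beta_power s_beta_\<zeta>[OF assms] h5_heis_power mult.assoc)
  also have "\<dots> = \<zeta> ^ (res5 (- (3 * a * c)) + res5 (3 * (a * ?a * (c * ?d) - a * ?c * (c * ?b)))) *
      h5_heis (a * ?a + c * ?b) (a * ?c + c * ?d)"
    by (simp add: h5_heis_mult power_add mult.assoc)
  also have "\<zeta> ^ (res5 (- (3 * a * c)) + res5 (3 * (a * ?a * (c * ?d) - a * ?c * (c * ?b)))) = \<zeta> ^ 0"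
  proof (rule power_cong_5[OF \<zeta>_pow_5])
    have "- (3 * a * c) + 3 * (a * ?a * (c * ?d) - a * ?c * (c * ?b)) =
        3 * a * c * ((?a * ?d - ?b * ?c) - 1)"
      by (rule ring5)
    then have "- (3 * a * c) + 3 * (a * ?a * (c * ?d) - a * ?c * (c * ?b)) = 0"
      unfolding det by simp
    then show "of_nat (res5 (- (3 * a * c)) + res5 (3 * (a * ?a * (c * ?d) - a * ?c * (c * ?b)))) =
        (of_nat 0 :: 5)"
      by simp
  qed
  finally show ?thesis by (simp add: mult.commute)
qed

lemma s_beta_one: "s_beta (mat 1) h = h"
proof (induction h rule: h5_induct)
  have [simp]: "res5 0 = 0" by (simp add: res5_def)
  have "res5 1 \<le> 1" unfolding res5_def by (rule Least_le) simp
  moreover have "res5 1 \<noteq> 0" by (metis of_nat_0 of_nat_res5 zero_neq_one)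
  ultimately have [simp]: "res5 1 = 1" by simp
  have "h5_heis 1 0 = \<sigma>" "h5_heis 0 1 = \<tau>" by (simp_all add: h5_heis_def)
  then show "s_beta (mat 1) h = h \<Longrightarrow> s_beta (mat 1) (\<sigma> * h) = \<sigma> * h"
    "s_beta (mat 1) h = h \<Longrightarrow> s_beta (mat 1) (\<tau> * h) = \<tau> * h" for h
    by (simp_all add: mat_def)
qed simp

lemma s_beta_mult:
  assumes "det \<gamma> = 1"
  shows "s_beta (\<gamma> ** \<gamma>') h = s_beta \<gamma> (s_beta \<gamma>' h)"
  by (induction h rule: h5_induct)
    (simp_all add: s_beta_heis[OF assms] matrix_matrix_mult_def sum_2)

definition H5_plus :: "(h5 \<times> (5^2^2)) monoid"
  where "H5_plus =
    \<lparr>carrier = UNIV \<times> carrier SL,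
     monoid.mult = (\<lambda>(h, \<gamma>) (h', \<gamma>'). (h * s_beta \<gamma> h', \<gamma> ** \<gamma>')),
     one = (1, mat 1)\<rparr>"


lemma group_H5_plus: "group H5_plus"
proof (rule groupI)
  fix x assume "x \<in> carrier H5_plus"
  then obtain h \<gamma> where x: "x = (h, \<gamma>)" "det \<gamma> = 1" by (auto simp: H5_plus_def SL_def)
  define \<delta> :: "5^2^2" where
    "\<delta> = (\<chi> i j. if i = 1 then if j = 1 then \<gamma>$2$2 else - \<gamma>$1$2
                 else if j = 1 then - \<gamma>$2$1 else \<gamma>$1$1)"
  have "det \<delta> = 1" "\<delta> ** \<gamma> = mat 1"
    using x(2) by (auto simp: \<delta>_def det_2 vec_eq_iff forall_2 matrix_matrix_mult_def sum_2 mat_def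
        algebra_simps)
  then have "(inverse (s_beta \<delta> h), \<delta>) \<in> carrier H5_plus"
    "(inverse (s_beta \<delta> h), \<delta>) \<otimes>\<^bsub>H5_plus\<^esub> x = \<one>\<^bsub>H5_plus\<^esub>"
    by (simp_all add: H5_plus_def SL_def x)
  then show "\<exists>y\<in>carrier H5_plus. y \<otimes>\<^bsub>H5_plus\<^esub> x = \<one>\<^bsub>H5_plus\<^esub>" by blast
qed (auto simp: H5_plus_def SL_def det_mul s_beta_mult s_beta_one matrix_mul_assoc mult.assoc)


section \<open>The space \<open>\<Lambda>\<^sup>2V \<otimes> W\<close> and the Hesse family\<close>

text \<open>
  The space \<open>\<Lambda>\<^sup>2V \<otimes> W\<close> is realised as the tensors in \<open>V \<otimes> V \<otimes> W\<close> that are alternating in the first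
  two slots, \<open>v \<and> v'\<close> being \<open>v \<otimes> v' - v' \<otimes> v\<close>.
\<close>

definition wedge2V_W :: "('k::field ^ 5 ^ 5 ^ 5) set"
  where "wedge2V_W = {\<phi>. \<forall>i j k. \<phi>$i$i$k = 0 \<and> \<phi>$i$j$k = - \<phi>$j$i$k}"

definition wedge_tensor :: "'k::field ^ 5 \<Rightarrow> 'k ^ 5 \<Rightarrow> 'k ^ 5 \<Rightarrow> 'k ^ 5 ^ 5 ^ 5"
  where "wedge_tensor v v' w = (\<chi> i j k. (v$i * v'$j - v$j * v'$i) * w$k)"

definition act :: "('k::field ^ 5 ^ 5) \<times> ('k ^ 5 ^ 5) \<Rightarrow> 'k ^ 5 ^ 5 ^ 5 \<Rightarrow> 'k ^ 5 ^ 5 ^ 5"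
  where "act g \<phi> =
    (\<chi> i j k. \<Sum>a\<in>UNIV. \<Sum>b\<in>UNIV. \<Sum>c\<in>UNIV. fst g$i$a * fst g$j$b * snd g$k$c * \<phi>$a$b$c)"

lemma wedge_tensor_in_wedge2V_W: "wedge_tensor v v' w \<in> wedge2V_W"
  by (auto simp: wedge2V_W_def wedge_tensor_def algebra_simps)

lemma wedge2V_W_decomposition:
  assumes "\<phi> \<in> wedge2V_W"
  shows "\<phi> = (\<Sum>i\<in>UNIV. \<Sum>j\<in>{i<..}. \<Sum>k\<in>UNIV.
    wedge_tensor (axis i (\<phi>$i$j$k)) (axis j 1) (axis k 1))" (is "_ = ?R")
proof -
  have diff_if: "(\<Sum>j\<in>J. (if P then f j else 0) - (if Q then g j else 0)) =
      (if P then \<Sum>j\<in>J. f j else 0) - (if Q then \<Sum>j\<in>J. g j else 0)"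
    for J :: "5 set" and P Q and f g :: "5 \<Rightarrow> 'a"
    by (simp add: sum_subtractf)
  have "?R $ p $ q $ r = \<phi> $ p $ q $ r" for p q r
  proof -
    have "?R $ p $ q $ r = (\<Sum>i\<in>UNIV. \<Sum>j\<in>{i<..}. \<Sum>k\<in>UNIV.
        if k = r then (if i = p then if j = q then \<phi>$i$j$k else 0 else 0)
          - (if i = q then if j = p then \<phi>$i$j$k else 0 else 0) else 0)"
      unfolding sum_component by (intro sum.cong refl) (auto simp: wedge_tensor_def axis_def)
    also have "\<dots> = (\<Sum>i\<in>UNIV. \<Sum>j\<in>{i<..}.
        (if i = p then if j = q then \<phi>$i$j$r else 0 else 0)
          - (if i = q then if j = p then \<phi>$i$j$r else 0 else 0))"
      by simp
    also have "\<dots> =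
        (\<Sum>i\<in>UNIV. if i = p then (\<Sum>j\<in>{i<..}. if j = q then \<phi>$i$j$r else 0) else 0)
        - (\<Sum>i\<in>UNIV. if i = q then (\<Sum>j\<in>{i<..}. if j = p then \<phi>$i$j$r else 0) else 0)"
      unfolding sum_subtractf[symmetric] by (rule sum.cong[OF refl diff_if])
    also have "\<dots> = (if p < q then \<phi>$p$q$r else 0) - (if q < p then \<phi>$q$p$r else 0)"
      by simp
    also have "\<dots> = \<phi>$p$q$r"
    proof -
      have "\<phi>$p$q$r = - \<phi>$q$p$r" "\<phi>$p$p$r = 0"
        using assms unfolding wedge2V_W_def by blast+
      then show ?thesis by (cases p q rule: linorder_cases) auto
    qed
    finally show ?thesis .
  qed
  then show ?thesis by (simp add: vec_eq_iff)
qed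

lemma act_wedge_tensor:
  "act (A, B) (wedge_tensor v v' w) = wedge_tensor (A *v v) (A *v v') (B *v w)"
proof -
  have prod3: "(\<Sum>a\<in>UNIV. f a) * (\<Sum>b\<in>UNIV. g b) * (\<Sum>c\<in>UNIV. h c) =
      (\<Sum>a\<in>UNIV. \<Sum>b\<in>UNIV. \<Sum>c\<in>UNIV. f a * g b * h c)" for f g h :: "5 \<Rightarrow> 'a"
    by (simp only: sum_distrib_left[symmetric] sum_distrib_right[symmetric])
  have "act (A, B) (wedge_tensor v v' w) $ i $ j $ k =
      wedge_tensor (A *v v) (A *v v') (B *v w) $ i $ j $ k" for i j k
  proof -
    have "act (A, B) (wedge_tensor v v' w) $ i $ j $ k =
        (\<Sum>a\<in>UNIV. \<Sum>b\<in>UNIV. \<Sum>c\<in>UNIV.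
          (A$i$a * v$a) * (A$j$b * v'$b) * (B$k$c * w$c)) -
        (\<Sum>a\<in>UNIV. \<Sum>b\<in>UNIV. \<Sum>c\<in>UNIV.
          (A$i$a * v'$a) * (A$j$b * v$b) * (B$k$c * w$c))"
      unfolding sum_subtractf[symmetric]
      by (simp add: act_def wedge_tensor_def algebra_simps)
    then show ?thesis
      unfolding prod3[symmetric]
      by (simp add: wedge_tensor_def matrix_vector_mult_def algebra_simps)
  qed
  then show ?thesis by (simp add: vec_eq_iff)
qed

definition hesse :: "'k::field ^ 2 \<Rightarrow> 'k ^ 5 ^ 5 ^ 5"
  where "hesse p =
    (\<chi> i j k. p$1 * (\<Sum>m\<in>UNIV. wedge_tensor (axis (1 + m) 1) (axis (4 + m) 1) (axis m 1))$i$j$k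
           + p$2 * (\<Sum>m\<in>UNIV. wedge_tensor (axis (2 + m) 1) (axis (3 + m) 1) (axis m 1))$i$j$k)"


section \<open>Representations and polynomial maps\<close>

text \<open>The algebra of functions generated by a set \<open>S\<close> of functions.\<close>

inductive_set fun_algebra :: "('x \<Rightarrow> 'k::comm_ring_1) set \<Rightarrow> ('x \<Rightarrow> 'k) set"
  for S :: "('x \<Rightarrow> 'k) set"
  where
    fun_algebra_const: "(\<lambda>_. c) \<in> fun_algebra S"
  | fun_algebra_gen: "p \<in> S \<Longrightarrow> p \<in> fun_algebra S"
  | fun_algebra_add: "p \<in> fun_algebra S \<Longrightarrow> q \<in> fun_algebra S \<Longrightarrow> (\<lambda>x. p x + q x) \<in> fun_algebra S"
  | fun_algebra_mult: "p \<in> fun_algebra S \<Longrightarrow> q \<in> fun_algebra S \<Longrightarrow> (\<lambda>x. p x * q x) \<in> fun_algebra S"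

text \<open>
  A map from \<open>X\<close> to a finite-dimensional space \<open>Y\<close> all of whose coordinates (in any basis) are given
  on \<open>X\<close> by elements of the algebra generated by \<open>S\<close>.
\<close>

definition regular_map ::
    "'x set \<Rightarrow> ('x \<Rightarrow> 'k::field) set \<Rightarrow> ('k \<Rightarrow> 'y::ab_group_add \<Rightarrow> 'y) \<Rightarrow> ('x \<Rightarrow> 'y) \<Rightarrow> bool"
  where "regular_map X S smul F \<longleftrightarrow>
    (\<forall>l. Vector_Spaces.linear smul (*) l \<longrightarrow>
      (\<exists>p\<in>fun_algebra S. \<forall>x\<in>X. l (F x) = p x))"

definition plane_coords :: "('k ^ 2 \<Rightarrow> 'k) set"
  where "plane_coords = {q. \<exists>i. q = (\<lambda>p. p$i)}"

definition tensor_coords :: "('k ^ 5 ^ 5 ^ 5 \<Rightarrow> 'k) set"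
  where "tensor_coords = {q. \<exists>i j k. q = (\<lambda>\<phi>. \<phi>$i$j$k)}"

text \<open>Generators of the coordinate ring of the algebraic group \<open>GL(V) \<times> GL(W)\<close>.\<close>

definition GL_coords :: "(('k::field ^ 5 ^ 5) \<times> ('k ^ 5 ^ 5) \<Rightarrow> 'k) set"
  where "GL_coords =
    {q. \<exists>i j. q = (\<lambda>g. fst g$i$j)} \<union> {q. \<exists>i j. q = (\<lambda>g. snd g$i$j)} \<union>
    {\<lambda>g. inverse (det (fst g)), \<lambda>g. inverse (det (snd g))}"

text \<open>A linear representation \<open>\<pi>\<close> of the group \<open>G\<close> on the subspace \<open>Z\<close>; only the values of
  \<open>\<pi>\<close> on \<open>carrier G\<close> and \<open>Z\<close> matter.\<close>

definition linear_rep ::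
    "('g, 'm) monoid_scheme \<Rightarrow> ('k::field \<Rightarrow> 'y::ab_group_add \<Rightarrow> 'y) \<Rightarrow> 'y set \<Rightarrow>
      ('g \<Rightarrow> 'y \<Rightarrow> 'y) \<Rightarrow> bool"
  where "linear_rep G smul Z \<pi> \<longleftrightarrow>
    module.subspace smul Z \<and>
    (\<forall>g\<in>carrier G. \<forall>y\<in>Z. \<pi> g y \<in> Z) \<and>
    (\<forall>g\<in>carrier G. \<forall>y\<in>Z. \<forall>y'\<in>Z. \<pi> g (y + y') = \<pi> g y + \<pi> g y') \<and>
    (\<forall>g\<in>carrier G. \<forall>c. \<forall>y\<in>Z. \<pi> g (smul c y) = smul c (\<pi> g y)) \<and>
    (\<forall>y\<in>Z. \<pi> \<one>\<^bsub>G\<^esub> y = y) \<and>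
    (\<forall>g\<in>carrier G. \<forall>h\<in>carrier G. \<forall>y\<in>Z. \<pi> (g \<otimes>\<^bsub>G\<^esub> h) y = \<pi> g (\<pi> h y))"

definition rational_rep ::
    "('k::field \<Rightarrow> 'y::ab_group_add \<Rightarrow> 'y) \<Rightarrow>
      (('k ^ 5 ^ 5) \<times> ('k ^ 5 ^ 5) \<Rightarrow> 'y \<Rightarrow> 'y) \<Rightarrow> bool"
  where "rational_rep smul \<rho> \<longleftrightarrow>
    linear_rep (GL \<times>\<times> GL) smul UNIV \<rho> \<and>
    (\<forall>y. regular_map (carrier (GL \<times>\<times> GL)) GL_coords smul (\<lambda>g. \<rho> g y))"

definition covariant ::
    "('k::field \<Rightarrow> 'y::ab_group_add \<Rightarrow> 'y) \<Rightarrow>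
      (('k ^ 5 ^ 5) \<times> ('k ^ 5 ^ 5) \<Rightarrow> 'y \<Rightarrow> 'y) \<Rightarrow> ('k ^ 5 ^ 5 ^ 5 \<Rightarrow> 'y) \<Rightarrow> bool"
  where "covariant smul \<rho> F \<longleftrightarrow>
    regular_map wedge2V_W tensor_coords smul F \<and>
    (\<forall>g\<in>carrier (SL \<times>\<times> SL). \<forall>\<phi>\<in>wedge2V_W. F (act g \<phi>) = \<rho> g (F \<phi>))"


section \<open>The actions of \<open>H\<^sub>5\<^sup>+\<close> and discrete covariants\<close>

text \<open>
  A representation of \<open>H\<^sub>5\<^sup>+\<close> on \<open>V\<close> (resp. \<open>W\<close>) is determined by being a homomorphism to \<open>GL\<close> that
  takes the prescribed values on the generators \<open>\<sigma>\<close> and \<open>\<tau>\<close> of \<open>H\<^sub>5\<close>; that its values have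
  determinant 1 is a consequence, because \<open>SL\<^sub>2(\<int>/5\<int>)\<close> is perfect.
\<close>

definition extends_theta_V :: "'k::field \<Rightarrow> (h5 \<times> (5^2^2) \<Rightarrow> 'k ^ 5 ^ 5) \<Rightarrow> bool"
  where "extends_theta_V z \<theta> \<longleftrightarrow> \<theta> \<in> hom H5_plus GL \<and>
    (\<forall>i. \<theta> (\<sigma>, mat 1) *v axis i 1 = axis i (z ^ (2 * res5 i)) \<and>
         \<theta> (\<tau>, mat 1) *v axis i 1 = axis (i + 1) 1)"

definition extends_theta_W :: "'k::field \<Rightarrow> (h5 \<times> (5^2^2) \<Rightarrow> 'k ^ 5 ^ 5) \<Rightarrow> bool"
  where "extends_theta_W z \<theta> \<longleftrightarrow> \<theta> \<in> hom H5_plus GL \<and>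
    (\<forall>i. \<theta> (\<sigma>, mat 1) *v axis i 1 = axis i (z ^ res5 i) \<and>
         \<theta> (\<tau>, mat 1) *v axis i 1 = axis (i + 1) 1)"

definition theta ::
    "(h5 \<times> (5^2^2) \<Rightarrow> 'k ^ 5 ^ 5) \<Rightarrow> (h5 \<times> (5^2^2) \<Rightarrow> 'k ^ 5 ^ 5) \<Rightarrow>
      (('k ^ 5 ^ 5) \<times> ('k ^ 5 ^ 5) \<Rightarrow> 'y \<Rightarrow> 'y) \<Rightarrow> h5 \<times> (5^2^2) \<Rightarrow> 'y \<Rightarrow> 'y"
  where "theta \<theta>V \<theta>W \<rho> x = \<rho> (\<theta>V x, \<theta>W x)"

definition H5_fixed :: "(h5 \<times> (5^2^2) \<Rightarrow> 'y \<Rightarrow> 'y) \<Rightarrow> 'y set"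
  where "H5_fixed \<theta>Y = {y. \<forall>h. \<theta>Y (h, mat 1) y = y}"

text \<open>Existence of the matrix in the following description holds because the image of \<open>hesse\<close> is
  the space of \<open>H\<^sub>5\<close>-invariants, uniqueness because \<open>hesse\<close> is injective.\<close>

definition chi1 ::
    "(h5 \<times> (5^2^2) \<Rightarrow> 'k::field ^ 5 ^ 5) \<Rightarrow> (h5 \<times> (5^2^2) \<Rightarrow> 'k ^ 5 ^ 5) \<Rightarrow> 5^2^2 \<Rightarrow> 'k ^ 2 ^ 2"
  where "chi1 \<theta>V \<theta>W \<gamma> =
    (THE M. \<forall>p. hesse (M *v p) = theta \<theta>V \<theta>W act (1, \<gamma>) (hesse p))"

definition discrete_covariant ::
    "(5^2^2 \<Rightarrow> 'k::field ^ 2 ^ 2) \<Rightarrow> ('k \<Rightarrow> 'y::ab_group_add \<Rightarrow> 'y) \<Rightarrow> 'y set \<Rightarrow>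
      (5^2^2 \<Rightarrow> 'y \<Rightarrow> 'y) \<Rightarrow> ('k ^ 2 \<Rightarrow> 'y) \<Rightarrow> bool"
  where "discrete_covariant \<chi>1 smul Z \<pi> f \<longleftrightarrow>
    linear_rep SL smul Z \<pi> \<and>
    range f \<subseteq> Z \<and> regular_map UNIV plane_coords smul f \<and>
    (\<forall>\<gamma>\<in>carrier SL. \<forall>p. f (\<chi>1 \<gamma> *v p) = \<pi> \<gamma> (f p))"

end

theory Submission
  imports Defs
begin

text \<open>
  The values of the two representations lie in \<open>SL\<close> because \<open>H\<^sub>5\<^sup>+\<close> is perfect, so a covariant
  intertwines the two actions of \<open>H\<^sub>5\<^sup>+\<close>; together with the computation of the \<open>H\<^sub>5\<close>-invariants
  this gives the discrete covariance.

  For uniqueness, the difference of two covariants that agree on the Hesse family vanishes on the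
  \<open>GL(V) \<times> GL(W)\<close>-orbit of the family.  The tangent map
  \<open>(X, Y, q) \<mapsto> (X, Y) \<cdot> u(p) + u(q)\<close> is onto at a suitable point \<open>p = (a, 1)\<close>: it splits into circulant
  systems, one for each weight of \<open>\<sigma>\<close>, whose determinants are up to units the discriminant
  \<open>a\<^sup>1\<^sup>0 - 11 a\<^sup>5 - 1\<close> (and 5 for the zero weight).  By Newton iteration every line
  through \<open>u(p)\<close> is approximated to any order by a polynomial arc in the orbit, so a polynomial that
  vanishes on the orbit vanishes on every such line.  This works in every characteristic other than 5.
\<close>

section \<open>Polynomial functions of one variable\<close>

text \<open>Divisibility by \<open>s ^ N\<close> among polynomial functions: applied to a difference
  it expresses congruence modulo \<open>s ^ N\<close>, while \<open>N = 0\<close> says only that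
  \<open>f\<close> is polynomial.\<close>

definition poly_fun :: "nat \<Rightarrow> ('k::field \<Rightarrow> 'k) \<Rightarrow> bool"
  where "poly_fun N f \<longleftrightarrow> (\<exists>r. \<forall>s. f s = s ^ N * poly r s)"

lemma poly_funI: "(\<And>s. f s = s ^ N * poly r s) \<Longrightarrow> poly_fun N f"
  unfolding poly_fun_def by blast

lemma poly_fun_add:
  assumes "poly_fun N f" "poly_fun N g" shows "poly_fun N (\<lambda>s. f s + g s)"
proof -
  obtain p q where "\<And>s. f s = s ^ N * poly p s" "\<And>s. g s = s ^ N * poly q s"
    using assms unfolding poly_fun_def by blast
  then show ?thesis by (intro poly_funI[where r = "p + q"]) (simp add: algebra_simps)
qed

lemma poly_fun_mult:
  assumes "poly_fun M f" "poly_fun N g" shows "poly_fun (M + N) (\<lambda>s. f s * g s)"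
proof -
  obtain p q where "\<And>s. f s = s ^ M * poly p s" "\<And>s. g s = s ^ N * poly q s"
    using assms unfolding poly_fun_def by blast
  then show ?thesis by (intro poly_funI[where r = "p * q"]) (simp add: algebra_simps power_add)
qed

lemma poly_fun_const: "poly_fun 0 (\<lambda>_. c)"
  by (rule poly_funI[where r = "[:c:]"]) simp

lemma poly_fun_power: "poly_fun N (\<lambda>s. s ^ N * c)"
  by (rule poly_funI[where r = "[:c:]"]) simp

lemma poly_fun_zero: "poly_fun N (\<lambda>_. 0)"
  by (rule poly_funI[where r = 0]) simp

lemma poly_fun_minus: "poly_fun N f \<Longrightarrow> poly_fun N (\<lambda>s. - f s)"
  using poly_fun_mult[OF poly_fun_const[of "- 1"], of N f] by simp

lemma poly_fun_diff: "poly_fun N f \<Longrightarrow> poly_fun N g \<Longrightarrow> poly_fun N (\<lambda>s. f s - g s)"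
  using poly_fun_add[OF _ poly_fun_minus, of N f g] by simp

lemma poly_fun_mono:
  assumes "poly_fun N f" "M \<le> N" shows "poly_fun M f"
proof -
  obtain p where "\<And>s. f s = s ^ N * poly p s"
    using assms(1) unfolding poly_fun_def by blast
  then show ?thesis
    using assms(2) by (intro poly_funI[where r = "monom 1 (N - M) * p"])
      (simp add: poly_monom power_add[symmetric] mult.assoc[symmetric])
qed

lemma poly_fun_sum: "(\<And>i. i \<in> I \<Longrightarrow> poly_fun N (f i)) \<Longrightarrow> poly_fun N (\<lambda>s. \<Sum>i\<in>I. f i s)"
  by (induction I rule: infinite_finite_induct) (simp_all add: poly_fun_add poly_fun_zero)

lemma poly_fun_prod: "(\<And>i. i \<in> I \<Longrightarrow> poly_fun 0 (f i)) \<Longrightarrow> poly_fun 0 (\<lambda>s. \<Prod>i\<in>I. f i s)"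
proof (induction I rule: infinite_finite_induct)
  case (insert i I)
  then show ?case using poly_fun_mult[of 0 "f i" 0] by simp
qed (simp_all add: poly_fun_const)

lemma poly_fun_diff_value_0:
  assumes "poly_fun 0 f" shows "poly_fun 1 (\<lambda>s. f s - f 0)"
proof -
  obtain p where p: "\<And>s. f s = poly p s" using assms unfolding poly_fun_def by auto
  show ?thesis
    by (cases p) (use p in \<open>auto intro!: poly_funI\<close>)
qed

lemma poly_fun_eq_0:
  assumes "poly_fun 0 f" "infinite {s. f s = 0}" shows "f s = 0"
proof -
  obtain p where p: "\<And>s. f s = poly p s" using assms unfolding poly_fun_def by auto
  then have "p = 0" using assms(2) poly_roots_finite[of p] by auto
  then show ?thesis using p by simp
qed

text \<open>A nonzero polynomial is not divisible by a power of \<open>s\<close> beyond its degree,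
  so the exponent \<open>Suc (degree p)\<close> decides. Infinitely many points turn equal functions
  into equal polynomials.\<close>

lemma poly_fun_all_eq_0:
  fixes f :: "'k::field \<Rightarrow> 'k"
  assumes "infinite (UNIV :: 'k set)" "\<And>N. poly_fun N f" shows "f s = 0"
proof -
  obtain p where p: "\<And>s. f s = poly p s" using assms(2)[of 0] unfolding poly_fun_def by auto
  define N where "N = Suc (degree p)"
  obtain q where q: "\<And>s. f s = s ^ N * poly q s" using assms(2)[of N] unfolding poly_fun_def by auto
  have "\<forall>s. poly (p - monom 1 N * q) s = 0" using p q by (simp add: poly_monom)
  then have "p - monom 1 N * q = 0"
    using assms(1) poly_roots_finite[of "p - monom 1 N * q"] by auto
  then have pq: "p = monom 1 N * q" by simp
  have "p = 0"
  proof (rule ccontr)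
    assume "p \<noteq> 0"
    then have "q \<noteq> 0" using pq by auto
    then have "degree p = N + degree q"
      unfolding pq by (subst degree_mult_eq) (auto simp: degree_monom_eq)
    then show False by (simp add: N_def)
  qed
  then show ?thesis using p by simp
qed

text \<open>Over a finite field, one plus the product of all \<open>X - c\<close> has positive
  degree but takes the value 1 everywhere.\<close>

lemma infinite_UNIV_alg_closed: "infinite (UNIV :: 'k::alg_closed_field set)"
proof
  assume fin: "finite (UNIV :: 'k set)"
  define p :: "'k poly" where "p = (\<Prod>c\<in>UNIV. [:- c, 1:])"
  have "degree p = card (UNIV :: 'k set)"
    unfolding p_def by (subst degree_prod_eq_sum_degree) auto
  then have "degree (p + 1) > 0"
    using fin by (subst degree_add_eq_left) (auto simp: card_gt_0_iff)
  then obtain x where "poly (p + 1) x = 0" using alg_closed_imp_poly_has_root by blast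
  moreover have "poly p x = 0" unfolding p_def poly_prod using fin by (auto intro!: prod_zero)
  ultimately show False by simp
qed

section \<open>Polynomial maps evaluated along polynomial curves\<close>

lemma fun_algebra_poly_fun:
  assumes "P \<in> fun_algebra S" "\<And>q. q \<in> S \<Longrightarrow> poly_fun 0 (\<lambda>s. q (c s))"
  shows "poly_fun 0 (\<lambda>s. P (c s))"
  using assms(1)
proof induction
  case (fun_algebra_mult p q)
  then show ?case using poly_fun_mult[of 0 _ 0] by simp
qed (simp_all add: poly_fun_const poly_fun_add assms(2))

text \<open>Polynomial maps respect congruence modulo \<open>s ^ N\<close>. A product telescopes as
  \<open>(p - p') q + p' (q - q')\<close>, which is why both curves have to be polynomial.\<close>

lemma fun_algebra_poly_fun_cong:
  assumes "P \<in> fun_algebra S"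
    and c: "\<And>q. q \<in> S \<Longrightarrow> poly_fun 0 (\<lambda>s. q (c s))" "\<And>q. q \<in> S \<Longrightarrow> poly_fun 0 (\<lambda>s. q (c' s))"
    and cong: "\<And>q. q \<in> S \<Longrightarrow> poly_fun N (\<lambda>s. q (c s) - q (c' s))"
  shows "poly_fun N (\<lambda>s. P (c s) - P (c' s))"
  using assms(1)
proof induction
  case (fun_algebra_const a)
  then show ?case by (simp add: poly_fun_zero)
next
  case (fun_algebra_gen p)
  then show ?case by (rule cong)
next
  case (fun_algebra_add p q)
  then show ?case using poly_fun_add[OF fun_algebra_add.IH] by (simp add: algebra_simps)
next
  case (fun_algebra_mult p q)
  have "poly_fun (N + 0) (\<lambda>s. (p (c s) - p (c' s)) * q (c s))"
    using fun_algebra_mult fun_algebra_poly_fun[OF _ c(1)] by (intro poly_fun_mult)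
  moreover have "poly_fun (0 + N) (\<lambda>s. p (c' s) * (q (c s) - q (c' s)))"
    using fun_algebra_mult fun_algebra_poly_fun[OF _ c(2)] by (intro poly_fun_mult)
  ultimately have "poly_fun N (\<lambda>s. (p (c s) - p (c' s)) * q (c s) + p (c' s) * (q (c s) - q (c' s)))"
    by (intro poly_fun_add) simp_all
  then show ?case by (simp add: algebra_simps)
qed

text \<open>\<open>f'\<close> agrees with \<open>f + s\<^sup>N d\<close> to first order beyond \<open>s\<^sup>N\<close>, where \<open>f 0 = c\<close>; the pairs
  \<open>(c, d)\<close> multiply like dual numbers.\<close>

definition jet :: "nat \<Rightarrow> ('k::field \<Rightarrow> 'k) \<Rightarrow> ('k \<Rightarrow> 'k) \<Rightarrow> 'k \<Rightarrow> 'k \<Rightarrow> bool"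
  where "jet N f f' c d \<longleftrightarrow> poly_fun 0 f \<and> poly_fun 1 (\<lambda>s. f s - c) \<and>
    poly_fun (Suc N) (\<lambda>s. f' s - f s - s ^ N * d)"

lemma jet_const: "jet N (\<lambda>_. c) (\<lambda>_. c) c 0"
  by (simp add: jet_def poly_fun_const poly_fun_zero)

lemma jet_perturb:
  assumes "poly_fun 0 f" "f 0 = c" shows "jet N f (\<lambda>s. f s + s ^ N * d) c d"
  using assms poly_fun_diff_value_0[of f] by (auto simp: jet_def poly_fun_zero)

lemma jet_add:
  assumes "jet N f f' c d" "jet N g g' a b"
  shows "jet N (\<lambda>s. f s + g s) (\<lambda>s. f' s + g' s) (c + a) (d + b)"
proof -
  have "poly_fun 1 (\<lambda>s. (f s - c) + (g s - a))"
    "poly_fun (Suc N) (\<lambda>s. (f' s - f s - s ^ N * d) + (g' s - g s - s ^ N * b))"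
    using assms unfolding jet_def by (simp_all add: poly_fun_add)
  then show ?thesis
    using assms unfolding jet_def by (auto intro: poly_fun_add simp: algebra_simps)
qed

lemma jet_sum:
  "(\<And>i. i \<in> I \<Longrightarrow> jet N (f i) (f' i) (c i) (d i)) \<Longrightarrow>
    jet N (\<lambda>s. \<Sum>i\<in>I. f i s) (\<lambda>s. \<Sum>i\<in>I. f' i s) (\<Sum>i\<in>I. c i) (\<Sum>i\<in>I. d i)"
  by (induction I rule: infinite_finite_induct) (simp_all add: jet_add jet_const)

text \<open>Leibniz rule. The assumption \<open>N > 0\<close> makes the perturbation vanish at 0, so
  \<open>g'\<close> still takes the value \<open>a\<close> there.\<close>

lemma jet_mult:
  assumes f: "jet N f f' c d" and g: "jet N g g' a b" and "N > 0"
  shows "jet N (\<lambda>s. f s * g s) (\<lambda>s. f' s * g' s) (c * a) (c * b + d * a)"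
proof -
  have F: "poly_fun 0 f" "poly_fun 1 (\<lambda>s. f s - c)" "poly_fun (Suc N) (\<lambda>s. f' s - f s - s ^ N * d)"
    and G: "poly_fun 0 g" "poly_fun 1 (\<lambda>s. g s - a)" "poly_fun (Suc N) (\<lambda>s. g' s - g s - s ^ N * b)"
    using f g by (simp_all add: jet_def)
  have sN: "poly_fun N (\<lambda>s. s ^ N * e)" for e :: 'a by (rule poly_fun_power)
  have "poly_fun 1 (\<lambda>s. (g' s - g s - s ^ N * b) + (s ^ N * b) + (g s - a))"
    using assms(3) by (intro poly_fun_add poly_fun_mono[OF G(3)] poly_fun_mono[OF sN] G(2)) auto
  then have G': "poly_fun 1 (\<lambda>s. g' s - a)" by simp
  have G'0: "poly_fun 0 g'"
    using poly_fun_add[OF poly_fun_mono[OF G'] poly_fun_const[of a]] by simp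
  have 1: "poly_fun 0 (\<lambda>s. f s * g s)" using poly_fun_mult[OF F(1) G(1)] by simp
  have "poly_fun 1 (\<lambda>s. (f s - c) * g s + c * (g s - a))"
    using poly_fun_mult[OF F(2) G(1)] poly_fun_mult[OF poly_fun_const G(2)]
    by (intro poly_fun_add) simp_all
  then have 2: "poly_fun 1 (\<lambda>s. f s * g s - c * a)" by (simp add: algebra_simps)
  \<comment> \<open>The error of the product splits into four terms: each contains either an error
    of order \<open>Suc N\<close>, or \<open>s ^ N\<close> times a deviation from the value at
    0.\<close>
  have "poly_fun (Suc N) (\<lambda>s. f s * (g' s - g s - s ^ N * b))"
    using poly_fun_mult[OF F(1) G(3)] by simp
  moreover have "poly_fun (Suc N) (\<lambda>s. (s ^ N * b) * (f s - c))"
    using poly_fun_mult[OF sN F(2)] by simp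
  moreover have "poly_fun (Suc N) (\<lambda>s. (f' s - f s - s ^ N * d) * g' s)"
    using poly_fun_mult[OF F(3) G'0] by simp
  moreover have "poly_fun (Suc N) (\<lambda>s. (s ^ N * d) * (g' s - a))"
    using poly_fun_mult[OF sN G'] by simp
  ultimately have "poly_fun (Suc N) (\<lambda>s. f s * (g' s - g s - s ^ N * b) + (s ^ N * b) * (f s - c)
      + (f' s - f s - s ^ N * d) * g' s + (s ^ N * d) * (g' s - a))"
    by (intro poly_fun_add)
  then have "poly_fun (Suc N) (\<lambda>s. f' s * g' s - f s * g s - s ^ N * (c * b + d * a))"
    by (simp add: algebra_simps)
  then show ?thesis using 1 2 by (simp add: jet_def)
qed

section \<open>The tangent map of the action at the Hesse family\<close>

text \<open>The derivative of \<open>act\<close> at the identity, that is, the Lie algebra action by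
  the product rule over the three tensor slots.\<close>

definition dact :: "'k::field ^ 5 ^ 5 \<Rightarrow> 'k ^ 5 ^ 5 \<Rightarrow> 'k ^ 5 ^ 5 ^ 5 \<Rightarrow> 'k ^ 5 ^ 5 ^ 5"
  where "dact X Y \<phi> = (\<chi> i j k. (\<Sum>a\<in>UNIV. X$i$a * \<phi>$a$j$k) + (\<Sum>b\<in>UNIV. X$j$b * \<phi>$i$b$k) +
    (\<Sum>c\<in>UNIV. Y$k$c * \<phi>$i$j$c))"

definition tensor_scale :: "'k::field \<Rightarrow> 'k ^ 5 ^ 5 ^ 5 \<Rightarrow> 'k ^ 5 ^ 5 ^ 5"
  where "tensor_scale c \<phi> = (\<chi> i j k. c * \<phi>$i$j$k)"

lemma tensor_scale_nth [simp]: "tensor_scale c \<phi> $ i $ j $ k = c * \<phi> $ i $ j $ k"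
  by (simp add: tensor_scale_def)

section \<open>Linearity and multiplicativity of the action, and its effect on alternating
  tensors\<close>

lemma act_nested:
  "act g \<phi> $ i $ j $ k =
    (\<Sum>a\<in>UNIV. fst g$i$a * (\<Sum>b\<in>UNIV. fst g$j$b * (\<Sum>c\<in>UNIV. snd g$k$c * \<phi>$a$b$c)))"
  by (simp add: act_def sum_distrib_left mult.assoc)

lemma act_add: "act g (\<phi> + \<psi>) = act g \<phi> + act g \<psi>"
  by (simp add: vec_eq_iff act_nested sum.distrib algebra_simps)

lemma act_scale: "act g (tensor_scale c \<phi>) = tensor_scale c (act g \<phi>)"
  by (simp add: vec_eq_iff act_def sum_distrib_left algebra_simps)

lemma act_sum: "act g (\<Sum>i\<in>I. \<phi> i) = (\<Sum>i\<in>I. act g (\<phi> i))"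
proof -
  have "act g 0 = 0" by (simp add: vec_eq_iff act_def)
  then show ?thesis by (induction I rule: infinite_finite_induct) (simp_all add: act_add)
qed

lemma act_one: "act (mat 1, mat 1) \<phi> = \<phi>"
  by (simp add: vec_eq_iff act_nested mat_def if_distrib[of "\<lambda>x. x * _"] cong: if_cong)

text \<open>The action is a composite of three operators, one for each slot. Operators on the same
  slot compose like matrices, and operators on different slots commute.\<close>

lemma act_mult: "act (A ** A', B ** B') \<phi> = act (A, B) (act (A', B') \<phi>)"
proof -
  define R where "R M \<phi> = (\<chi> i j k. \<Sum>c\<in>UNIV. M$k$c * \<phi>$i$j$c)" for M :: "'a^5^5" and \<phi> :: "'a^5^5^5"
  define Q where "Q M \<phi> = (\<chi> i j k. \<Sum>b\<in>UNIV. M$j$b * \<phi>$i$b$k)" for M :: "'a^5^5" and \<phi> :: "'a^5^5^5"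
  define P where "P M \<phi> = (\<chi> i j k. \<Sum>a\<in>UNIV. M$i$a * \<phi>$a$j$k)" for M :: "'a^5^5" and \<phi> :: "'a^5^5^5"
  have mul: "(\<Sum>a\<in>UNIV. (M ** N)$i$a * f a) = (\<Sum>a\<in>UNIV. M$i$a * (\<Sum>b\<in>UNIV. N$a$b * f b))"
    for M N :: "'a^5^5" and f i
    unfolding matrix_matrix_mult_def sum_distrib_left sum_distrib_right vec_lambda_beta
    by (subst sum.swap) (simp add: mult.assoc)
  have swap: "(\<Sum>a\<in>UNIV. f a * (\<Sum>b\<in>UNIV. g b * h a b)) = (\<Sum>b\<in>UNIV. g b * (\<Sum>a\<in>UNIV. f a * h a b))"
    for f g :: "5 \<Rightarrow> 'a" and h
    unfolding sum_distrib_left by (subst sum.swap) (simp add: ac_simps)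
  have comp: "P (M ** N) \<phi> = P M (P N \<phi>)" "Q (M ** N) \<phi> = Q M (Q N \<phi>)" "R (M ** N) \<phi> = R M (R N \<phi>)"
    for M N \<phi>
    by (simp_all add: P_def Q_def R_def vec_eq_iff mul)
  have commute: "R N (P M \<phi>) = P M (R N \<phi>)" "R N (Q M \<phi>) = Q M (R N \<phi>)" "Q N (P M \<phi>) = P M (Q N \<phi>)"
    for M N \<phi>
    by (simp_all add: P_def Q_def R_def vec_eq_iff) (rule swap allI)+
  have "act (A, B) \<phi> = P A (Q A (R B \<phi>))" for A B and \<phi> :: "'a^5^5^5"
    by (simp add: vec_eq_iff act_nested P_def Q_def R_def)
  then show ?thesis by (simp add: comp commute)
qed

lemma wedge2V_W_iff:
  "\<phi> \<in> wedge2V_W \<longleftrightarrow> (\<forall>i k. \<phi>$i$i$k = 0) \<and> (\<forall>i j k. \<phi>$i$j$k + \<phi>$j$i$k = 0)"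
  unfolding wedge2V_W_def eq_neg_iff_add_eq_0 by blast

lemma wedge2V_W_add: "\<phi> \<in> wedge2V_W \<Longrightarrow> \<psi> \<in> wedge2V_W \<Longrightarrow> \<phi> + \<psi> \<in> wedge2V_W"
  by (simp add: wedge2V_W_iff algebra_simps)

lemma wedge2V_W_sum: "(\<And>i. i \<in> I \<Longrightarrow> \<phi> i \<in> wedge2V_W) \<Longrightarrow> (\<Sum>i\<in>I. \<phi> i) \<in> wedge2V_W"
proof (induction I rule: infinite_finite_induct)
qed (simp_all add: wedge2V_W_add, simp_all add: wedge2V_W_iff)

text \<open>Pure wedge tensors are sent to pure wedge tensors, and they generate the space
  additively.\<close>

lemma act_in_wedge2V_W:
  assumes "\<phi> \<in> wedge2V_W" shows "act g \<phi> \<in> wedge2V_W"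
proof -
  show ?thesis
    by (subst wedge2V_W_decomposition[OF assms], cases g)
      (simp add: act_sum act_wedge_tensor wedge2V_W_sum wedge_tensor_in_wedge2V_W)
qed

lemma wedge2V_W_scale: "\<phi> \<in> wedge2V_W \<Longrightarrow> tensor_scale c \<phi> \<in> wedge2V_W"
  by (simp add: wedge2V_W_iff distrib_left[symmetric])

lemma wedge2V_W_diff:
  assumes "\<phi> \<in> wedge2V_W" "\<psi> \<in> wedge2V_W" shows "\<phi> - \<psi> \<in> wedge2V_W"
proof -
  have "\<phi> - \<psi> = \<phi> + tensor_scale (- 1) \<psi>" by (simp add: vec_eq_iff)
  then show ?thesis by (metis assms wedge2V_W_add wedge2V_W_scale)
qed

section \<open>Coordinates, linearity and injectivity of the Hesse family\<close>

lemma hesse_eq: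
  "hesse p = tensor_scale (p$1) (\<Sum>m\<in>UNIV. wedge_tensor (axis (1 + m) 1) (axis (4 + m) 1) (axis m 1)) +
    tensor_scale (p$2) (\<Sum>m\<in>UNIV. wedge_tensor (axis (2 + m) 1) (axis (3 + m) 1) (axis m 1))"
  by (simp add: vec_eq_iff hesse_def)

lemma indicator_minor:
  "((if P then 1 else 0) * (if Q then 1 else 0) - (if R then 1 else 0) * (if S then 1 else 0)) *
    (if T then 1 else 0) =
    (if T then (if P \<and> Q then 1 else 0) - (if S \<and> R then 1 else 0) else (0 :: 'k::field))"
  by simp

lemma hesse_nth:
  "hesse p $ i $ j $ k =
    p$1 * ((if i = 1 + k \<and> j = 4 + k then 1 else 0) - (if i = 4 + k \<and> j = 1 + k then 1 else 0)) +
    p$2 * ((if i = 2 + k \<and> j = 3 + k then 1 else 0) - (if i = 3 + k \<and> j = 2 + k then 1 else 0))"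
proof -
  \<comment> \<open>The third slot \<open>axis m 1\<close> leaves only the summand
    \<open>m = k\<close>.\<close>
  have *: "(\<Sum>m\<in>UNIV. wedge_tensor (axis (u + m) 1) (axis (v + m) 1) (axis m 1)) $ i $ j $ k =
      (if i = u + k \<and> j = v + k then 1 else 0) - (if i = v + k \<and> j = u + k then 1 else (0::'a))" for u v
  proof -
    have "(\<Sum>m\<in>UNIV. wedge_tensor (axis (u + m) 1) (axis (v + m) 1) (axis m 1)) $ i $ j $ k =
      (\<Sum>m\<in>UNIV. if k = m then (if i = u + k \<and> j = v + k then 1 else 0) - (if i = v + k \<and> j = u + k then 1 else (0::'a)) else 0)"
      unfolding sum_component
    proof (intro sum.cong refl)
      fix m
      show "wedge_tensor (axis (u + m) 1) (axis (v + m) 1) (axis m 1) $ i $ j $ k =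
          (if k = m then (if i = u + k \<and> j = v + k then 1 else 0) - (if i = v + k \<and> j = u + k then 1 else (0::'a)) else 0)"
        unfolding wedge_tensor_def axis_def vec_lambda_beta indicator_minor
        by (cases "k = m") (simp_all only: if_True if_False)
    qed
    then show ?thesis by simp
  qed
  show ?thesis unfolding hesse_def by (simp only: vec_lambda_beta *)
qed

lemma hesse_in_wedge2V_W: "hesse p \<in> wedge2V_W"
  by (simp add: hesse_eq wedge2V_W_add wedge2V_W_scale wedge2V_W_sum wedge_tensor_in_wedge2V_W)

lemma hesse_add: "hesse (p + q) = hesse p + hesse q"
  by (simp add: vec_eq_iff hesse_def algebra_simps)

lemma hesse_scale: "hesse (c *s p) = tensor_scale c (hesse p)"
  by (simp add: vec_eq_iff hesse_def algebra_simps)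

lemma hesse_inject: "hesse p = hesse q \<longleftrightarrow> p = q"
proof
  assume "hesse p = hesse q"
  then have "hesse p $ 1 $ 4 $ 0 = hesse q $ 1 $ 4 $ 0" "hesse p $ 2 $ 3 $ 0 = hesse q $ 2 $ 3 $ 0"
    by simp_all
  then show "p = q" by (simp add: hesse_nth vec_eq_iff forall_2)
qed simp

text \<open>Product rule for \<open>act\<close> along curves through the identity and
  \<open>\<phi>0\<close>: perturbations of order \<open>s ^ N\<close> contribute their first-order
  effect, \<open>dact\<close> from the group and \<open>\<psi>\<close> from the tensor.\<close>

lemma jet_act:
  assumes A: "\<And>i j. jet N (\<lambda>s. A s$i$j) (\<lambda>s. A' s$i$j) (mat 1$i$j) (X$i$j)"
    and B: "\<And>i j. jet N (\<lambda>s. B s$i$j) (\<lambda>s. B' s$i$j) (mat 1$i$j) (Y$i$j)"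
    and \<phi>: "\<And>i j k. jet N (\<lambda>s. \<phi> s$i$j$k) (\<lambda>s. \<phi>' s$i$j$k) (\<phi>0$i$j$k) (\<psi>$i$j$k)"
    and "N > 0"
  shows "jet N (\<lambda>s. act (A s, B s) (\<phi> s)$i$j$k) (\<lambda>s. act (A' s, B' s) (\<phi>' s)$i$j$k)
    (\<phi>0$i$j$k) ((dact X Y \<phi>0 + \<psi>)$i$j$k)"
proof -
  \<comment> \<open>The sums are treated from the inside out, \<open>W\<close> first and then the
    two copies of \<open>V\<close>; after each one the identity matrix collapses the unperturbed
    part.\<close>
  have one: "mat 1 $ i $ a * x = (if i = a then x else 0)" for i a :: 5 and x :: 'a
    by (simp add: mat_def)
  have "jet N (\<lambda>s. \<Sum>c\<in>UNIV. B s$k$c * \<phi> s$a$b$c) (\<lambda>s. \<Sum>c\<in>UNIV. B' s$k$c * \<phi>' s$a$b$c)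
      (\<Sum>c\<in>UNIV. mat 1$k$c * \<phi>0$a$b$c) (\<Sum>c\<in>UNIV. mat 1$k$c * \<psi>$a$b$c + Y$k$c * \<phi>0$a$b$c)" for a b
    by (intro jet_sum jet_mult B \<phi> \<open>N > 0\<close>)
  then have 1: "jet N (\<lambda>s. \<Sum>c\<in>UNIV. B s$k$c * \<phi> s$a$b$c) (\<lambda>s. \<Sum>c\<in>UNIV. B' s$k$c * \<phi>' s$a$b$c)
      (\<phi>0$a$b$k) (\<psi>$a$b$k + (\<Sum>c\<in>UNIV. Y$k$c * \<phi>0$a$b$c))" for a b
    by (simp add: one sum.distrib)
  have "jet N (\<lambda>s. \<Sum>b\<in>UNIV. A s$j$b * (\<Sum>c\<in>UNIV. B s$k$c * \<phi> s$a$b$c))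
      (\<lambda>s. \<Sum>b\<in>UNIV. A' s$j$b * (\<Sum>c\<in>UNIV. B' s$k$c * \<phi>' s$a$b$c))
      (\<Sum>b\<in>UNIV. mat 1$j$b * \<phi>0$a$b$k)
      (\<Sum>b\<in>UNIV. mat 1$j$b * (\<psi>$a$b$k + (\<Sum>c\<in>UNIV. Y$k$c * \<phi>0$a$b$c)) + X$j$b * \<phi>0$a$b$k)" for a
    by (intro jet_sum jet_mult A 1 \<open>N > 0\<close>)
  then have 2: "jet N (\<lambda>s. \<Sum>b\<in>UNIV. A s$j$b * (\<Sum>c\<in>UNIV. B s$k$c * \<phi> s$a$b$c))
      (\<lambda>s. \<Sum>b\<in>UNIV. A' s$j$b * (\<Sum>c\<in>UNIV. B' s$k$c * \<phi>' s$a$b$c))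
      (\<phi>0$a$j$k) (\<psi>$a$j$k + (\<Sum>c\<in>UNIV. Y$k$c * \<phi>0$a$j$c) + (\<Sum>b\<in>UNIV. X$j$b * \<phi>0$a$b$k))" for a
    by (simp add: one sum.distrib)
  have "jet N (\<lambda>s. \<Sum>a\<in>UNIV. A s$i$a * (\<Sum>b\<in>UNIV. A s$j$b * (\<Sum>c\<in>UNIV. B s$k$c * \<phi> s$a$b$c)))
      (\<lambda>s. \<Sum>a\<in>UNIV. A' s$i$a * (\<Sum>b\<in>UNIV. A' s$j$b * (\<Sum>c\<in>UNIV. B' s$k$c * \<phi>' s$a$b$c)))
      (\<Sum>a\<in>UNIV. mat 1$i$a * \<phi>0$a$j$k)
      (\<Sum>a\<in>UNIV. mat 1$i$a * (\<psi>$a$j$k + (\<Sum>c\<in>UNIV. Y$k$c * \<phi>0$a$j$c) +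
        (\<Sum>b\<in>UNIV. X$j$b * \<phi>0$a$b$k)) + X$i$a * \<phi>0$a$j$k)"
    by (intro jet_sum jet_mult A 2 \<open>N > 0\<close>)
  then show ?thesis
    by (simp add: one sum.distrib act_nested dact_def add_ac)
qed

text \<open>Newton iteration: if the error has order \<open>Suc N\<close> and leading coefficient
  \<open>R\<close>, the tangent equation is solved for \<open>- R\<close>, and
  \<open>s ^ Suc N\<close> times the solution is added to the arc, which raises the order by
  one.\<close>

lemma hesse_newton:
  fixes p0 :: "'k::alg_closed_field ^ 2"
  assumes surj: "\<And>y. y \<in> wedge2V_W \<Longrightarrow> \<exists>X Y q. dact X Y (hesse p0) + hesse q = y"
    and y: "y \<in> wedge2V_W"
  shows "\<exists>A B p. (\<forall>i j. poly_fun 0 (\<lambda>s. A s$i$j)) \<and> (\<forall>i j. poly_fun 0 (\<lambda>s. B s$i$j)) \<and>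
    (\<forall>i. poly_fun 0 (\<lambda>s. p s$i)) \<and> A 0 = mat 1 \<and> B 0 = mat 1 \<and> p 0 = p0 \<and>
    (\<forall>i j k. poly_fun (Suc N)
      (\<lambda>s. (act (A s, B s) (hesse (p s)) - hesse p0 - tensor_scale s y)$i$j$k))"
proof (induction N)
  case 0
  \<comment> \<open>The constant arc misses the line by exactly \<open>- s y\<close>.\<close>
  have "poly_fun 1 (\<lambda>s. (act (mat 1, mat 1) (hesse p0) - hesse p0 - tensor_scale s y)$i$j$k)" for i j k
    using poly_fun_minus[OF poly_fun_power[of 1 "y$i$j$k"]] by (simp add: act_one)
  then show ?case
    by (intro exI[of _ "\<lambda>_. mat 1"] exI[of _ "\<lambda>_. p0"]) (simp add: poly_fun_const)
next
  case (Suc N)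
  then obtain A B p where A: "\<And>i j. poly_fun 0 (\<lambda>s. A s$i$j)" "A 0 = mat 1"
    and B: "\<And>i j. poly_fun 0 (\<lambda>s. B s$i$j)" "B 0 = mat 1"
    and p: "\<And>i. poly_fun 0 (\<lambda>s. p s$i)" "p 0 = p0"
    and err: "\<And>i j k. poly_fun (Suc N)
      (\<lambda>s. (act (A s, B s) (hesse (p s)) - hesse p0 - tensor_scale s y)$i$j$k)"
    by auto
  define E where "E s = act (A s, B s) (hesse (p s)) - hesse p0 - tensor_scale s y" for s
  define M where "M = Suc N"
  obtain r where r: "\<And>i j k s. E s$i$j$k = s ^ M * poly (r i j k) s"
    using err unfolding poly_fun_def E_def M_def by metis
  define R where "R = (\<chi> i j k. poly (r i j k) 0)"
  have E: "E s \<in> wedge2V_W" for s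
    unfolding E_def
    by (intro wedge2V_W_diff wedge2V_W_scale act_in_wedge2V_W hesse_in_wedge2V_W y)
  \<comment> \<open>The alternating relations of \<open>E s\<close> can be divided by
    \<open>s ^ M\<close> only for \<open>s \<noteq> 0\<close>; being polynomial identities at
    infinitely many points they extend to 0, where \<open>R\<close> is read off.\<close>
  have inf: "infinite (UNIV - {0 :: 'k})" using infinite_UNIV_alg_closed by simp
  have "poly (r i i k) s = 0" "poly (r i j k + r j i k) s = 0" for i j k s
  proof -
    have "E s$i$i$k = 0" "E s$i$j$k = - E s$j$i$k" for s
      using E[of s] unfolding wedge2V_W_def by blast+
    then have "UNIV - {0} \<subseteq> {s. poly (r i i k) s = 0}" "UNIV - {0} \<subseteq> {s. poly (r i j k + r j i k) s = 0}"
      using r by (auto simp: algebra_simps eq_neg_iff_add_eq_0)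
        (metis distrib_left mult_eq_0_iff power_not_zero)
    then have "infinite {s. poly (r i i k) s = 0}" "infinite {s. poly (r i j k + r j i k) s = 0}"
      using inf infinite_super by blast+
    then show "poly (r i i k) s = 0" "poly (r i j k + r j i k) s = 0"
      by (metis poly_0 poly_roots_finite)+
  qed
  then have "R \<in> wedge2V_W" by (auto simp: R_def wedge2V_W_def eq_neg_iff_add_eq_0)
  then have "tensor_scale (- 1) R \<in> wedge2V_W" by (rule wedge2V_W_scale)
  then obtain X Y q where XYq: "dact X Y (hesse p0) + hesse q = tensor_scale (- 1) R"
    using surj by blast
  define A' where "A' s = A s + (\<chi> i j. s ^ M * X$i$j)" for s
  define B' where "B' s = B s + (\<chi> i j. s ^ M * Y$i$j)" for s
  define p' where "p' s = p s + s ^ M *s q" for s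
  have pw: "poly_fun 0 (\<lambda>s. s ^ M * c)" for c :: 'k
    by (rule poly_fun_mono[OF poly_fun_power]) simp
  have jA: "jet M (\<lambda>s. A s$i$j) (\<lambda>s. A' s$i$j) (mat 1$i$j) (X$i$j)" for i j
    using jet_perturb[OF A(1)[of i j]] A(2) by (simp add: A'_def)
  have jB: "jet M (\<lambda>s. B s$i$j) (\<lambda>s. B' s$i$j) (mat 1$i$j) (Y$i$j)" for i j
    using jet_perturb[OF B(1)[of i j]] B(2) by (simp add: B'_def)
  have hp: "poly_fun 0 (\<lambda>s. hesse (p s)$i$j$k)" for i j k
    unfolding hesse_nth using p(1) poly_fun_const
    by (intro poly_fun_add poly_fun_mult[of 0 _ 0, simplified])
  have jp: "jet M (\<lambda>s. hesse (p s)$i$j$k) (\<lambda>s. hesse (p' s)$i$j$k) (hesse p0$i$j$k) (hesse q$i$j$k)" for i j k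
    using jet_perturb[OF hp[of i j k]] p(2) by (simp add: p'_def hesse_add hesse_scale)
  have "poly_fun (Suc (Suc N)) (\<lambda>s. (act (A' s, B' s) (hesse (p' s)) - hesse p0 - tensor_scale s y)$i$j$k)"
    for i j k
  proof -
    \<comment> \<open>The new error is the change of the orbit point corrected by
      \<open>s ^ M * R\<close>, plus the old error \<open>E s\<close> without its leading term; the
      two multiples of \<open>R\<close> cancel.\<close>
    have "poly_fun (Suc M) (\<lambda>s. act (A' s, B' s) (hesse (p' s))$i$j$k - act (A s, B s) (hesse (p s))$i$j$k
        - s ^ M * - R$i$j$k)"
      using jet_act[OF jA jB jp, of i j k] unfolding XYq by (simp add: jet_def M_def)
    moreover have "poly_fun (M + 1) (\<lambda>s. s ^ M * (poly (r i j k) s - poly (r i j k) 0))"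
      using poly_fun_power[of M 1] poly_fun_diff_value_0[OF poly_funI[of "poly (r i j k)" 0 "r i j k"]]
      by (intro poly_fun_mult) simp_all
    ultimately have "poly_fun (Suc M) (\<lambda>s. (act (A' s, B' s) (hesse (p' s))$i$j$k -
        act (A s, B s) (hesse (p s))$i$j$k - s ^ M * - R$i$j$k) +
        s ^ M * (poly (r i j k) s - poly (r i j k) 0))"
      by (intro poly_fun_add) simp_all
    moreover have eq: "s ^ M * (poly (r i j k) s - poly (r i j k) 0) = E s$i$j$k - s ^ M * R$i$j$k" for s
      by (simp add: r R_def right_diff_distrib)
    moreover have "act (A' s, B' s) (hesse (p' s))$i$j$k - act (A s, B s) (hesse (p s))$i$j$k
        - s ^ M * - R$i$j$k + (E s$i$j$k - s ^ M * R$i$j$k) =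
        (act (A' s, B' s) (hesse (p' s)) - hesse p0 - tensor_scale s y)$i$j$k" for s
      by (simp add: E_def)
    ultimately show ?thesis by (simp only: M_def)
  qed
  moreover have "poly_fun 0 (\<lambda>s. A' s$i$j)" "poly_fun 0 (\<lambda>s. B' s$i$j)" "poly_fun 0 (\<lambda>s. p' s$l)" for i j l
    using poly_fun_add[OF A(1)[of i j] pw[of "X$i$j"]] poly_fun_add[OF B(1)[of i j] pw[of "Y$i$j"]]
      poly_fun_add[OF p(1)[of l] pw[of "q$l"]]
    by (simp_all add: A'_def B'_def p'_def)
  moreover have "A' 0 = mat 1" "B' 0 = mat 1" "p' 0 = p0"
    using A B p by (simp_all add: A'_def B'_def p'_def M_def vec_eq_iff)
  ultimately show ?case by blast
qed

section \<open>The representations of \<open>H\<^sub>5\<^sup>+\<close>\<close>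

lemma five_cases:
  fixes c :: 5 obtains "c = 0" | "c = 1" | "c = 2" | "c = 3" | "c = 4"
proof (cases c)
  case (of_int z)
  then have "z \<in> {0, 1, 2, 3, 4}" by auto
  then show ?thesis using of_int that by auto
qed

lemma five_mult_eq_0 [simp]: "5 * c = (0 :: 5)"
  by (cases c rule: five_cases) simp_all

lemma five_inverse:
  fixes c :: 5 assumes "c \<noteq> 0" obtains e where "e * c = 1"
proof (cases c rule: five_cases)
  case 1 then show ?thesis using assms by simp
next
  case 2 then show ?thesis using that[of 1] by simp
next
  case 3 then show ?thesis using that[of 3] by simp
next
  case 4 then show ?thesis using that[of 2] by simp
next
  case 5 then show ?thesis using that[of 4] by simp
qed

definition mat2 :: "'a \<Rightarrow> 'a \<Rightarrow> 'a \<Rightarrow> 'a \<Rightarrow> 'a ^ 2 ^ 2"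
  where "mat2 a b c d = (\<chi> i j. if i = 1 then if j = 1 then a else b else if j = 1 then c else d)"

lemma mat2_nth [simp]:
  "mat2 a b c d $ 1 $ 1 = a" "mat2 a b c d $ 1 $ 2 = b" "mat2 a b c d $ 2 $ 1 = c" "mat2 a b c d $ 2 $ 2 = d"
  by (simp_all add: mat2_def)

lemma mat2_eq: "\<gamma> = mat2 (\<gamma>$1$1) (\<gamma>$1$2) (\<gamma>$2$1) (\<gamma>$2$2)"
  by (simp add: vec_eq_iff forall_2)

lemma mat2_mult:
  "mat2 a b c d ** mat2 a' b' c' d' =
    mat2 (a * a' + b * c') (a * b' + b * d') (c * a' + d * c') (c * b' + d * (d' :: 'a::comm_ring_1))"
  by (simp add: vec_eq_iff forall_2 matrix_matrix_mult_def sum_2)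

lemma mat2_det: "det (mat2 a b c d) = a * d - b * (c :: 'a::comm_ring_1)"
  by (simp add: det_2)

lemma matrix_nth_axis: "A $ i $ j = (A *v axis j (1 :: 'k::field)) $ i"
  by (simp add: matrix_vector_mult_def axis_def if_distrib[of "\<lambda>x. _ * x"] cong: if_cong)

lemma h5_heis_1_0: "h5_heis 1 0 = \<sigma>" and h5_heis_0_1: "h5_heis 0 1 = \<tau>"
proof -
  show "h5_heis 1 0 = \<sigma>"
    using h5_normal_cong[of "res5 0" 0 "res5 1" 1 "res5 0" 0] by (simp add: h5_heis_def)
  show "h5_heis 0 1 = \<tau>"
    using h5_normal_cong[of "res5 0" 0 "res5 0" 0 "res5 1" 1] by (simp add: h5_heis_def)
qed

lemma group_GL: "group (GL :: ('k::field ^ 'n ^ 'n) monoid)"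
proof (rule groupI)
  fix A :: "'k ^ 'n ^ 'n" assume "A \<in> carrier GL"
  then obtain A' where "A ** A' = mat 1" "A' ** A = mat 1" by (auto simp: GL_def invertible_def)
  then show "\<exists>B\<in>carrier GL. B \<otimes>\<^bsub>GL\<^esub> A = \<one>\<^bsub>GL\<^esub>" by (auto simp: GL_def invertible_def)
next
  have "mat 1 ** mat 1 = (mat 1 :: 'k ^ 'n ^ 'n)" by simp
  then show "\<one>\<^bsub>GL\<^esub> \<in> carrier (GL :: ('k ^ 'n ^ 'n) monoid)" by (auto simp: GL_def invertible_def)
qed (auto simp: GL_def invertible_mult matrix_mul_assoc)

lemma H5_plus_simps:
  "x \<in> carrier H5_plus \<longleftrightarrow> det (snd x) = 1"
  "(h, \<gamma>) \<otimes>\<^bsub>H5_plus\<^esub> (h', \<gamma>') = (h * s_beta \<gamma> h', \<gamma> ** \<gamma>')"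
  "\<one>\<^bsub>H5_plus\<^esub> = (1, mat 1)"
  by (cases x) (simp_all add: H5_plus_def SL_def)

text \<open>\<open>H\<^sub>5\<^sup>+\<close> is perfect: conjugation by a diagonal matrix with entries 2, 3 squares
  \<open>\<sigma>\<close> or \<open>\<tau>\<close> and inverts the elementary matrices, which are of order 5.\<close>

lemma H5_plus_character_trivial:
  fixes \<psi> :: "h5 \<times> (5^2^2) \<Rightarrow> 'k::field"
  assumes mult: "\<And>x y. x \<in> carrier H5_plus \<Longrightarrow> y \<in> carrier H5_plus \<Longrightarrow>
      \<psi> (x \<otimes>\<^bsub>H5_plus\<^esub> y) = \<psi> x * \<psi> y"
    and nz: "\<And>x. x \<in> carrier H5_plus \<Longrightarrow> \<psi> x \<noteq> 0"
    and x: "x \<in> carrier H5_plus"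
  shows "\<psi> x = 1"
proof -
  let ?D = "mat2 2 0 0 3 :: 5^2^2" and ?D' = "mat2 3 0 0 2 :: 5^2^2"
  let ?U = "\<lambda>t. mat2 1 t 0 1 :: 5^2^2" and ?L = "\<lambda>t. mat2 1 0 t 1 :: 5^2^2"
  define f where "f \<gamma> = \<psi> (1, \<gamma>)" for \<gamma>
  define g where "g h = \<psi> (h, mat 1)" for h
  have f: "f (\<gamma> ** \<gamma>') = f \<gamma> * f \<gamma>'" if "det \<gamma> = 1" "det \<gamma>' = 1" for \<gamma> \<gamma>'
    using mult[of "(1, \<gamma>)" "(1, \<gamma>')"] that by (simp add: H5_plus_simps f_def)
  have f_nz: "f \<gamma> \<noteq> 0" if "det \<gamma> = 1" for \<gamma> using nz that by (simp add: H5_plus_simps f_def)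
  have g: "g (h * h') = g h * g h'" for h h'
    using mult[of "(h, mat 1)" "(h', mat 1)"] by (simp add: H5_plus_simps g_def s_beta_one)
  have g_nz: "g h \<noteq> 0" for h using nz by (simp add: H5_plus_simps g_def)
  have gf: "\<psi> (h, \<gamma>) = g h * f \<gamma>" if "det \<gamma> = 1" for h \<gamma>
    using mult[of "(h, mat 1)" "(1, \<gamma>)"] that by (simp add: H5_plus_simps g_def f_def)
  have fg: "\<psi> (s_beta \<gamma> h, \<gamma>) = f \<gamma> * g h" if "det \<gamma> = 1" for h \<gamma>
    using mult[of "(1, \<gamma>)" "(h, mat 1)"] that by (simp add: H5_plus_simps g_def f_def)
  \<comment> \<open>The element \<open>(s_beta \<gamma> h, \<gamma>)\<close> is a product of its two
    parts in either order, and the values of the character commute.\<close>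
  have g_s_beta: "g (s_beta \<gamma> h) = g h" if "det \<gamma> = 1" for h \<gamma>
    using gf[OF that] fg[OF that] f_nz[OF that] by (simp add: mult.commute)
  have g1: "g 1 = 1" using g[of 1 1] g_nz[of 1] by simp
  \<comment> \<open>Each of the two values equals its own square, hence is 1.\<close>
  have "s_beta ?D \<sigma> = \<sigma> * \<sigma>" "s_beta ?D' \<tau> = \<tau> * \<tau>"
    using h5_heis_power[of 1 0 2] h5_heis_power[of 0 1 2]
    by (simp_all add: h5_heis_1_0 h5_heis_0_1 power2_eq_square)
  then have "g \<sigma> = g \<sigma> * g \<sigma>" "g \<tau> = g \<tau> * g \<tau>"
    using g_s_beta[of ?D \<sigma>] g_s_beta[of ?D' \<tau>] by (simp_all add: mat2_det g)
  then have "g \<sigma> = 1" "g \<tau> = 1" using g_nz by simp_all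
  then have g_one: "g h = 1" for h by (induction h rule: h5_induct) (simp_all add: g g1)
  have trivial: "f (E t) = 1"
    if E: "\<And>s t. E (s + t) = E s ** E t" "\<And>t. det (E t) = 1" "\<And>t. ?D ** E t = E (4 * t) ** ?D" for E :: "5 \<Rightarrow> 5^2^2" and t
  proof -
    have add: "f (E (s + t)) = f (E s) * f (E t)" for s t using E f by simp
    have 0: "f (E 0) = 1" using add[of 0 0] f_nz[OF E(2)[of 0]] by simp
    have "f ?D * f (E t) = f (?D ** E t)" using f[of ?D "E t"] E(2) by (simp add: mat2_det)
    also have "\<dots> = f (E (4 * t)) * f ?D"
      unfolding E(3) using f[of "E (4 * t)" ?D] E(2) by (simp add: mat2_det)
    finally have "f ?D * f (E t) = f (E (4 * t)) * f ?D" .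
    then have 4: "f (E (4 * t)) = f (E t)" using f_nz[of ?D] by (simp add: mat2_det)
    \<comment> \<open>With \<open>x = f (E t)\<close>: conjugation gives \<open>x ^ 4 = x\<close>,
      so \<open>x ^ 3 = 1\<close>, while \<open>t + 4 * t = 0\<close> gives
      \<open>x ^ 2 = 1\<close>.\<close>
    have t: "4 * t = (t + t) + (t + t)" "t + 4 * t = 0" by (cases t rule: five_cases; simp)+
    then have "f (E (4 * t)) = f (E t) ^ 4" by (simp only: add) (simp add: eval_nat_numeral)
    then have "f (E t) * f (E t) ^ 3 = f (E t)" using 4 by (simp add: eval_nat_numeral)
    then have 3: "f (E t) ^ 3 = 1" using f_nz[OF E(2)[of t]] by simp
    have "f (E t) * f (E t) = 1" using add[of t "4 * t"] 4 0 unfolding t(2) by simp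
    then show ?thesis using 3 by (simp add: eval_nat_numeral)
  qed
  \<comment> \<open>These are the off-diagonal entries of \<open>?D ** E t = E (4 * t) ** ?D\<close>
    for the upper and lower elementary matrices.\<close>
  have twelve: "12 * t = 2 * t" and eight: "8 * t = 3 * t" for t :: 5
    by (cases t rule: five_cases; simp)+
  have U: "f (?U t) = 1" for t
    by (rule trivial[of ?U]) (simp_all add: mat2_mult mat2_det add.commute twelve)
  have L: "f (?L t) = 1" for t
    by (rule trivial[of ?L]) (simp_all add: mat2_mult mat2_det add.commute eight)
  have det1: "det (?U t) = 1" "det (?L t) = 1" for t by (simp_all add: mat2_det)
  \<comment> \<open>Bruhat factorisation: for invertible \<open>c\<close> the matrix is upper times
    lower times upper elementary, with parameters \<open>(a - 1) / c\<close>, \<open>c\<close>,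
    \<open>(d - 1) / c\<close>; \<open>e\<close> stands for \<open>1 / c\<close>.\<close>
  have f_c: "f \<gamma> = 1" if det: "det \<gamma> = 1" and c: "\<gamma>$2$1 \<noteq> 0" for \<gamma>
  proof -
    define a b c d where abcd: "a = \<gamma>$1$1" "b = \<gamma>$1$2" "c = \<gamma>$2$1" "d = \<gamma>$2$2"
    obtain e where e: "e * c = 1" using five_inverse[of c] c abcd by metis
    have ad: "a * d = 1 + b * c" using det by (simp add: det_2 abcd algebra_simps)
    have 1: "1 + e * (a - 1) * c = a" "c * (e * (d - 1)) + 1 = d"
    proof -
      have "e * (a - 1) * c = e * c * (a - 1)" "c * (e * (d - 1)) = e * c * (d - 1)"
        by (simp_all only: ac_simps)
      then show "1 + e * (a - 1) * c = a" "c * (e * (d - 1)) + 1 = d" by (simp_all add: e)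
    qed
    have "a * (e * (d - 1)) + e * (a - 1) = e * (a * d - 1)" by (simp add: algebra_simps)
    also have "\<dots> = (e * c) * b" by (simp add: ad algebra_simps)
    finally have 2: "a * (e * (d - 1)) + e * (a - 1) = b" using e by simp
    have "?U (e * (a - 1)) ** ?L c ** ?U (e * (d - 1)) = mat2 a b c d"
      using 1 2 by (simp add: mat2_mult)
    then have "\<gamma> = ?U (e * (a - 1)) ** (?L c ** ?U (e * (d - 1)))"
      using mat2_eq[of \<gamma>] by (simp add: abcd matrix_mul_assoc)
    moreover have "f (?U (e * (a - 1)) ** (?L c ** ?U (e * (d - 1)))) = 1"
      using U L det1 by (simp add: f det_mul)
    ultimately show ?thesis by simp
  qed
  have f_one: "f \<gamma> = 1" if det: "det \<gamma> = 1" for \<gamma>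
  proof (cases "\<gamma>$2$1 = 0")
    case True
    then have "\<gamma>$1$1 * \<gamma>$2$2 = 1" using det by (simp add: det_2)
    then have d: "\<gamma>$2$2 \<noteq> 0" by auto
    \<comment> \<open>In the triangular case multiplication by \<open>?L 1\<close> moves the unit
      \<open>d\<close> into the lower left corner.\<close>
    have "(\<gamma> ** ?L 1)$2$1 = \<gamma>$2$2" using True by (simp add: matrix_matrix_mult_def sum_2)
    then have "f (\<gamma> ** ?L 1) = 1" using d det det1 by (intro f_c) (simp_all add: det_mul)
    then show ?thesis using f[OF det det1(2)] L by simp
  qed (use f_c det in blast)
  obtain h \<gamma> where "x = (h, \<gamma>)" by (cases x)
  then show ?thesis using x gf g_one f_one by (simp add: H5_plus_simps)
qed

text \<open>The determinant of a representation is a character of a perfect group, hence trivial;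
  covariants are equivariant only under \<open>SL\<close>, so this is what makes them
  applicable.\<close>

lemma hom_H5_plus_GL:
  assumes "\<theta> \<in> hom H5_plus (GL :: ('k::field ^ 'n ^ 'n) monoid)"
  shows hom_H5_plus_GL_mult: "x \<in> carrier H5_plus \<Longrightarrow> y \<in> carrier H5_plus \<Longrightarrow>
      \<theta> (x \<otimes>\<^bsub>H5_plus\<^esub> y) = \<theta> x ** \<theta> y"
    and hom_H5_plus_GL_one: "\<theta> (1, mat 1) = mat 1"
    and hom_H5_plus_GL_invertible: "x \<in> carrier H5_plus \<Longrightarrow> invertible (\<theta> x)"
    and hom_H5_plus_GL_det: "x \<in> carrier H5_plus \<Longrightarrow> det (\<theta> x) = 1"
proof -
  show mult: "\<theta> (x \<otimes>\<^bsub>H5_plus\<^esub> y) = \<theta> x ** \<theta> y"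
    if "x \<in> carrier H5_plus" "y \<in> carrier H5_plus" for x y
    using hom_mult[OF assms that] by (simp add: GL_def)
  show "\<theta> (1, mat 1) = mat 1"
    using hom_one[OF assms group_H5_plus group_GL] by (simp add: H5_plus_simps GL_def)
  show inv: "invertible (\<theta> x)" if "x \<in> carrier H5_plus" for x
    using hom_in_carrier[OF assms that] by (simp add: GL_def)
  show "det (\<theta> x) = 1" if "x \<in> carrier H5_plus"
    using that inv by (intro H5_plus_character_trivial[of "\<lambda>x. det (\<theta> x)"])
      (simp_all add: mult det_mul invertible_det_nz)
qed

text \<open>The subgroup \<open>H5\<close> is normal:
  \<open>(h, 1) (1, \<gamma>) = (1, \<gamma>) (h', 1)\<close>, where \<open>h'\<close> is the image
  of \<open>h\<close> under the adjugate \<open>?\<delta>\<close>, the inverse of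
  \<open>\<gamma>\<close>.\<close>

lemma H5_fixed_stable:
  assumes mult: "\<And>x y v. x \<in> carrier H5_plus \<Longrightarrow> y \<in> carrier H5_plus \<Longrightarrow>
      \<pi> (x \<otimes>\<^bsub>H5_plus\<^esub> y) v = \<pi> x (\<pi> y v)"
    and v: "v \<in> H5_fixed \<pi>" and \<gamma>: "\<gamma> \<in> carrier SL"
  shows "\<pi> (1, \<gamma>) v \<in> H5_fixed \<pi>"
  unfolding H5_fixed_def
proof (intro CollectI allI)
  fix h
  have det: "det \<gamma> = 1" using \<gamma> by (simp add: SL_def)
  let ?\<delta> = "mat2 (\<gamma>$2$2) (- \<gamma>$1$2) (- \<gamma>$2$1) (\<gamma>$1$1)"
  have "\<gamma> ** ?\<delta> = mat 1"
    using det by (simp add: det_2 vec_eq_iff forall_2 matrix_matrix_mult_def sum_2 mat_def algebra_simps)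
  then have h: "s_beta \<gamma> (s_beta ?\<delta> h) = h"
    using s_beta_mult[OF det, of ?\<delta> h] by (simp add: s_beta_one)
  have "\<pi> (h, mat 1) (\<pi> (1, \<gamma>) v) = \<pi> ((h, mat 1) \<otimes>\<^bsub>H5_plus\<^esub> (1, \<gamma>)) v"
    using det by (intro mult[symmetric]) (simp_all add: H5_plus_simps)
  also have "(h, mat 1) \<otimes>\<^bsub>H5_plus\<^esub> (1, \<gamma>) = (1, \<gamma>) \<otimes>\<^bsub>H5_plus\<^esub> (s_beta ?\<delta> h, mat 1)"
    by (simp add: H5_plus_simps h)
  also have "\<pi> \<dots> v = \<pi> (1, \<gamma>) (\<pi> (s_beta ?\<delta> h, mat 1) v)"
    using det by (intro mult) (simp_all add: H5_plus_simps)
  also have "\<pi> (s_beta ?\<delta> h, mat 1) v = v"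
    using v by (simp add: H5_fixed_def)
  finally show "\<pi> (h, mat 1) (\<pi> (1, \<gamma>) v) = \<pi> (1, \<gamma>) v" .
qed

section \<open>The \<open>H\<^sub>5\<close>-invariants of \<open>\<Lambda>\<^sup>2V \<otimes> W\<close>\<close>

text \<open>This lets weights of \<open>\<sigma>\<close> be computed in the residue ring
  \<open>5\<close>.\<close>

lemma res5_power_eq_1_iff:
  fixes z :: "'k::field"
  assumes "z ^ 5 = 1" "\<forall>n. 0 < n \<and> n < 5 \<longrightarrow> z ^ n \<noteq> 1"
  shows "z ^ n = 1 \<longleftrightarrow> (of_nat n :: 5) = 0"
proof
  assume "(of_nat n :: 5) = 0"
  then show "z ^ n = 1" using power_cong_5[OF assms(1), of n 0] by simp
next
  assume z: "z ^ n = 1"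
  have n: "n = n mod 5 + 5 * (n div 5)" by simp
  have "z ^ n = z ^ (n mod 5)"
    using arg_cong[OF n, of "(^) z"] by (simp only: power_add power_mult assms(1) power_one mult_1_right)
  then have "n mod 5 = 0" using assms(2) z by (metis mod_less_divisor neq0_conv zero_less_numeral)
  then have "n = 5 * (n div 5)" by presburger
  then have "(of_nat n :: 5) = 5 * of_nat (n div 5)" by (metis of_nat_mult of_nat_numeral)
  then show "(of_nat n :: 5) = 0" by simp
qed

lemma wedge_tensor_axis:
  "wedge_tensor (axis i a) (axis j b) (axis k c) =
    tensor_scale (a * b * c) (wedge_tensor (axis i 1) (axis j 1) (axis k 1))"
  by (simp add: vec_eq_iff wedge_tensor_def axis_def)

lemma act_diagonal_nth:
  assumes A: "\<And>i. A *v axis i 1 = axis i (f i)" and B: "\<And>i. B *v axis i 1 = axis i (g i)"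
  shows "act (A, B) \<phi> $ i $ j $ k = f i * f j * g k * \<phi> $ i $ j $ k"
proof -
  have A_nth: "A $ i $ j = (if i = j then f j else 0)" for i j
    by (subst matrix_nth_axis) (simp add: A, simp add: axis_def)
  have B_nth: "B $ i $ j = (if i = j then g j else 0)" for i j
    by (subst matrix_nth_axis) (simp add: B, simp add: axis_def)
  show ?thesis
    by (simp add: act_nested A_nth B_nth if_distrib[of "\<lambda>x. x * _"] mult.assoc cong: if_cong)
qed

lemma act_shift_nth:
  assumes A: "\<And>i. A *v axis i 1 = axis (i + 1) 1" and B: "\<And>i. B *v axis i 1 = axis (i + 1) 1"
  shows "act (A, B) \<phi> $ (i + 1) $ (j + 1) $ (k + 1) = \<phi> $ i $ j $ k"
proof -
  have A_nth: "A $ (i + 1) $ j = (if i = j then 1 else 0)" for i j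
    by (subst matrix_nth_axis) (simp add: A, simp add: axis_def)
  have B_nth: "B $ (i + 1) $ j = (if i = j then 1 else 0)" for i j
    by (subst matrix_nth_axis) (simp add: B, simp add: axis_def)
  show ?thesis
    by (simp add: act_nested A_nth B_nth if_distrib[of "\<lambda>x. x * _"] cong: if_cong)
qed

context
  fixes z :: "'k::field" and \<theta>V \<theta>W :: "h5 \<times> (5^2^2) \<Rightarrow> 'k ^ 5 ^ 5"
  assumes z: "z ^ 5 = 1" "\<forall>n. 0 < n \<and> n < 5 \<longrightarrow> z ^ n \<noteq> 1"
    and \<theta>V: "extends_theta_V z \<theta>V" and \<theta>W: "extends_theta_W z \<theta>W"
begin

lemma \<theta>_hom: "\<theta>V \<in> hom H5_plus GL" "\<theta>W \<in> hom H5_plus GL"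
  using \<theta>V \<theta>W by (simp_all add: extends_theta_V_def extends_theta_W_def)

lemma \<theta>_\<sigma>: "\<theta>V (\<sigma>, mat 1) *v axis i 1 = axis i (z ^ (2 * res5 i))"
    "\<theta>W (\<sigma>, mat 1) *v axis i 1 = axis i (z ^ res5 i)"
  and \<theta>_\<tau>: "\<theta>V (\<tau>, mat 1) *v axis i 1 = axis (i + 1) 1" "\<theta>W (\<tau>, mat 1) *v axis i 1 = axis (i + 1) 1"
  using \<theta>V \<theta>W by (simp_all add: extends_theta_V_def extends_theta_W_def)

lemma \<theta>_SL: "x \<in> carrier H5_plus \<Longrightarrow> (\<theta>V x, \<theta>W x) \<in> carrier (SL \<times>\<times> SL)"
  using \<theta>_hom by (simp add: SL_def hom_H5_plus_GL_det)

lemma theta_act_mult: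
  assumes "x \<in> carrier H5_plus" "y \<in> carrier H5_plus"
  shows "theta \<theta>V \<theta>W act (x \<otimes>\<^bsub>H5_plus\<^esub> y) \<phi> = theta \<theta>V \<theta>W act x (theta \<theta>V \<theta>W act y \<phi>)"
  using assms by (simp add: theta_def hom_H5_plus_GL_mult[OF \<theta>_hom(1)] hom_H5_plus_GL_mult[OF \<theta>_hom(2)] act_mult)

text \<open>The summands have indices \<open>u + m\<close>, \<open>v + m\<close>, \<open>m\<close>
  with \<open>u + v = 0\<close>, so their weight is \<open>2 (u + v) + 5 m = 0\<close>.\<close>

lemma hesse_fixed_\<sigma>: "theta \<theta>V \<theta>W act (\<sigma>, mat 1) (hesse p) = hesse p"
proof -
  have "act (\<theta>V (\<sigma>, mat 1), \<theta>W (\<sigma>, mat 1)) (wedge_tensor (axis (u + m) 1) (axis (v + m) 1) (axis m 1)) =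
      wedge_tensor (axis (u + m) 1) (axis (v + m) 1) (axis m 1)" if "u + v = 0" for u v m
  proof -
    let ?e = "2 * res5 (u + m) + 2 * res5 (v + m) + res5 m"
    have "(of_nat ?e :: 5) = 2 * (u + v) + 5 * m" 
      by (cases u rule: five_cases; cases v rule: five_cases; cases m rule: five_cases; simp)
    also have "(5 :: 5) = 0" by simp
    also have "2 * (u + v) + 0 * m = 0" unfolding that by simp
    finally have "z ^ ?e = 1" unfolding res5_power_eq_1_iff[OF z] .
    then have "z ^ (2 * res5 (u + m)) * z ^ (2 * res5 (v + m)) * z ^ res5 m = 1"
      by (simp only: power_add)
    then show ?thesis
      unfolding act_wedge_tensor \<theta>_\<sigma> by (subst wedge_tensor_axis) (simp add: vec_eq_iff)
  qed
  then show ?thesis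
    by (simp add: theta_def hesse_eq act_add act_scale act_sum)
qed

text \<open>The shift merely reindexes the cyclic sums.\<close>

lemma hesse_fixed_\<tau>: "theta \<theta>V \<theta>W act (\<tau>, mat 1) (hesse p) = hesse p"
proof -
  have "(\<Sum>m\<in>UNIV. wedge_tensor (axis (u + m + 1) (1 :: 'k)) (axis (v + m + 1) 1) (axis (m + 1) 1)) =
      (\<Sum>m\<in>UNIV. wedge_tensor (axis (u + m) 1) (axis (v + m) 1) (axis m (1 :: 'k)))" for u v
    by (rule sum.reindex_bij_witness[of _ "\<lambda>m. m - 1" "\<lambda>m. m + 1"]) (simp_all add: add.assoc)
  then show ?thesis
    unfolding theta_def hesse_eq act_add act_scale act_sum act_wedge_tensor \<theta>_\<tau> by (simp only:)
qed

lemma hesse_in_H5_fixed: "hesse p \<in> H5_fixed (theta \<theta>V \<theta>W act)"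
proof -
  have "theta \<theta>V \<theta>W act (h, mat 1) (hesse p) = hesse p" for h
  proof (induction h rule: h5_induct)
    case 1
    then show ?case
      by (simp add: theta_def hom_H5_plus_GL_one[OF \<theta>_hom(1)] hom_H5_plus_GL_one[OF \<theta>_hom(2)] act_one)
  next
    case (2 h)
    then show ?case
      using theta_act_mult[of "(\<sigma>, mat 1)" "(h, mat 1)"]
      by (simp add: H5_plus_simps s_beta_one hesse_fixed_\<sigma>)
  next
    case (3 h)
    then show ?case
      using theta_act_mult[of "(\<tau>, mat 1)" "(h, mat 1)"]
      by (simp add: H5_plus_simps s_beta_one hesse_fixed_\<tau>)
  qed
  then show ?thesis by (simp add: H5_fixed_def)
qed

text \<open>Invariance under \<open>\<tau>\<close> moves every coordinate to \<open>k = 0\<close>,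
  and invariance under \<open>\<sigma>\<close> then forces \<open>i + j = 0\<close>. Up to skew
  symmetry only the two coordinates in the assumptions remain.\<close>

lemma H5_fixed_eq_0:
  assumes \<phi>: "\<phi> \<in> wedge2V_W" "\<phi> \<in> H5_fixed (theta \<theta>V \<theta>W act)"
    and "\<phi>$1$4$0 = 0" "\<phi>$2$3$0 = 0"
  shows "\<phi> = 0"
proof -
  have \<sigma>: "act (\<theta>V (\<sigma>, mat 1), \<theta>W (\<sigma>, mat 1)) \<phi> = \<phi>" and \<tau>: "act (\<theta>V (\<tau>, mat 1), \<theta>W (\<tau>, mat 1)) \<phi> = \<phi>"
    using \<phi>(2) by (simp_all add: H5_fixed_def theta_def)
  have shift1: "\<phi> $ (i + 1) $ (j + 1) $ (k + 1) = \<phi> $ i $ j $ k" for i j k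
    using act_shift_nth[OF \<theta>_\<tau>, of \<phi> i j k] unfolding \<tau> .
  have shift: "\<phi> $ (i + of_nat n) $ (j + of_nat n) $ (k + of_nat n) = \<phi> $ i $ j $ k" for i j k n
  proof (induction n)
    case (Suc n)
    then show ?case
      using shift1[of "i + of_nat n" "j + of_nat n" "k + of_nat n"] by (simp only: of_nat_Suc add_ac)
  qed simp
  have weight: "\<phi> $ i $ j $ k = 0" if "2 * i + 2 * j + k \<noteq> 0" for i j k
  proof -
    let ?e = "2 * res5 i + 2 * res5 j + res5 k"
    have "(of_nat ?e :: 5) = 2 * i + 2 * j + k" by simp
    then have "z ^ ?e \<noteq> 1" using that res5_power_eq_1_iff[OF z, of ?e] by metis
    then have "z ^ (2 * res5 i) * z ^ (2 * res5 j) * z ^ res5 k \<noteq> 1"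
      by (simp only: power_add not_False_eq_True)
    moreover have "z ^ (2 * res5 i) * z ^ (2 * res5 j) * z ^ res5 k * \<phi> $ i $ j $ k = \<phi> $ i $ j $ k"
      using act_diagonal_nth[OF \<theta>_\<sigma>, of \<phi> i j k] unfolding \<sigma> by simp
    ultimately show ?thesis by (metis mult_cancel_right mult_1)
  qed
  have skew: "\<phi> $ i $ j $ k = - \<phi> $ j $ i $ k" and diag: "\<phi> $ i $ i $ k = 0" for i j k
    using \<phi>(1) unfolding wedge2V_W_def by blast+
  have base: "\<phi> $ i $ j $ 0 = 0" for i j
  proof (cases "2 * i + 2 * j + 0 = 0")
    case True
    then have j: "j = - i" by (cases i rule: five_cases; cases j rule: five_cases; simp)
    have neg: "- (1 :: 5) = 4" "- (2 :: 5) = 3" "- (3 :: 5) = 2" "- (4 :: 5) = 1" by simp_all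
    show ?thesis
      using assms(3,4) skew[of 3 2 0] skew[of 4 1 0] diag[of 0 0] unfolding j
      by (cases i rule: five_cases) (simp_all only: neg minus_zero neg_0_equal_iff_equal)
  qed (rule weight)
  have "\<phi> $ i $ j $ k = 0" for i j k
    using shift[of "i - k" "res5 k" "j - k" 0] base by simp
  then show ?thesis by (simp add: vec_eq_iff)
qed

text \<open>Subtracting the Hesse member with the same two free coordinates leaves an invariant
  covered by \<open>H5_fixed_eq_0\<close>.\<close>

lemma H5_fixed_subset_range_hesse:
  assumes "\<phi> \<in> wedge2V_W" "\<phi> \<in> H5_fixed (theta \<theta>V \<theta>W act)"
  shows "\<phi> \<in> range hesse"
proof -
  define p :: "'k ^ 2" where "p = (\<chi> i. if i = 1 then \<phi>$1$4$0 else \<phi>$2$3$0)"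
  have diff: "act g (\<phi> - \<psi>) = act g \<phi> - act g \<psi>" for g and \<phi> \<psi> :: "'k^5^5^5"
    using act_add[of g "\<phi> - \<psi>" \<psi>] by simp
  have "\<phi> - hesse p \<in> H5_fixed (theta \<theta>V \<theta>W act)"
    using assms(2) hesse_in_H5_fixed[of p] by (simp add: H5_fixed_def theta_def diff)
  then have "\<phi> - hesse p = 0"
    using assms(1) by (intro H5_fixed_eq_0 wedge2V_W_diff hesse_in_wedge2V_W) (simp_all add: hesse_nth p_def)
  then show ?thesis by simp
qed

text \<open>Invariants are stable under the group, so each image is \<open>hesse (q p)\<close>; the
  matrix with columns \<open>q (axis j 1)\<close> works by linearity and is unique by injectivity of
  \<open>hesse\<close>. This justifies the description by \<open>THE\<close>.\<close>

lemma chi1: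
  assumes "\<gamma> \<in> carrier SL"
  shows "hesse (chi1 \<theta>V \<theta>W \<gamma> *v p) = theta \<theta>V \<theta>W act (1, \<gamma>) (hesse p)"
proof -
  let ?T = "\<lambda>\<phi>. theta \<theta>V \<theta>W act (1, \<gamma>) \<phi>"
  have "?T (hesse p) \<in> range hesse" for p
    using assms
    by (intro H5_fixed_subset_range_hesse H5_fixed_stable theta_act_mult hesse_in_H5_fixed)
      (simp_all add: theta_def act_in_wedge2V_W hesse_in_wedge2V_W)
  then obtain q where q: "?T (hesse p) = hesse (q p)" for p
    unfolding image_iff by metis
  define M where "M = (\<chi> i j. q (axis j 1) $ i)"
  have M: "hesse (M *v p) = ?T (hesse p)" for p
  proof -
    have p: "p = p$1 *s axis 1 1 + p$2 *s axis 2 1"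
      by (simp add: vec_eq_iff forall_2 axis_def)
    have "M *v p = p$1 *s q (axis 1 1) + p$2 *s q (axis 2 1)"
      by (simp add: M_def vec_eq_iff matrix_vector_mult_def sum_2 mult.commute)
    then have "hesse (M *v p) = tensor_scale (p$1) (?T (hesse (axis 1 1))) + tensor_scale (p$2) (?T (hesse (axis 2 1)))"
      by (simp add: hesse_add hesse_scale q)
    also have "\<dots> = ?T (hesse (p$1 *s axis 1 1 + p$2 *s axis 2 1))"
      by (simp add: hesse_add hesse_scale theta_def act_add act_scale)
    finally show ?thesis using p by simp
  qed
  have "\<exists>!M. \<forall>p. hesse (M *v p) = ?T (hesse p)"
  proof (rule ex1I[of _ M])
    fix N assume "\<forall>p. hesse (N *v p) = ?T (hesse p)"
    then have "\<forall>p. N *v p = M *v p" using M by (metis hesse_inject)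
    then show "N = M" by (simp add: matrix_eq)
  qed (simp add: M)
  from theI'[OF this] show ?thesis unfolding chi1_def by blast
qed

end

section \<open>Surjectivity of the tangent map\<close>

text \<open>The circulant operator \<open>1 + a T\<^sup>2 - a\<^sup>2 T\<^sup>4\<close> with \<open>T\<^sup>5 = 1\<close> has determinant
  \<open>-(a\<^sup>1\<^sup>0 - 11 a\<^sup>5 - 1)\<close>; the coefficients below are those of its adjugate.\<close>

lemma circulant_solve:
  fixes e :: "5 \<Rightarrow> 'k::field" and a :: 'k and r :: 5
  defines "g \<equiv> \<lambda>i. e i + a * e (i + 2 * r) - a ^ 2 * e (i + 4 * r)"
  shows "(1 + 3 * a ^ 5) * g i + (2 * a ^ 5 - 1) * a * g (i + 2 * r) + (2 + a ^ 5) * a ^ 2 * g (i + 4 * r)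
    + (a ^ 5 - 3) * a ^ 3 * g (i + r) + 5 * a ^ 4 * g (i + 3 * r) = (1 + 11 * a ^ 5 - a ^ 10) * e i"
proof -
  \<comment> \<open>Modulo 5 all arguments of \<open>e\<close> reduce to \<open>i + j * r\<close>
    with \<open>j < 5\<close>, which leaves a polynomial identity in five values.\<close>
  have r: "5 * r = 0" "6 * r = r" "7 * r = 2 * r" "8 * r = 3 * r"
    by (cases r rule: five_cases; simp)+
  have i: "i + 2 * r + 2 * r = i + 4 * r" "i + 2 * r + 4 * r = i + r"
    "i + 4 * r + 2 * r = i + r" "i + 4 * r + 4 * r = i + 3 * r" "i + r + 2 * r = i + 3 * r"
    "i + r + 4 * r = i" "i + 3 * r + 2 * r = i" "i + 3 * r + 4 * r = i + 2 * r"
    using r by (simp_all add: add.assoc mult_2[symmetric] distrib_right[symmetric])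
  show ?thesis unfolding g_def i by algebra
qed

section \<open>Product rule for \<open>dact\<close>, and the tangent space as a linear
  subspace\<close>

lemma tensor_scale_1 [simp]: "tensor_scale 1 \<phi> = \<phi>"
  by (simp add: vec_eq_iff)

lemma dact_add: "dact X Y (\<phi> + \<psi>) = dact X Y \<phi> + dact X Y \<psi>"
  by (simp add: vec_eq_iff dact_def sum.distrib algebra_simps)

lemma dact_scale: "dact X Y (tensor_scale c \<phi>) = tensor_scale c (dact X Y \<phi>)"
  by (simp add: vec_eq_iff dact_def sum_distrib_left algebra_simps)

lemma dact_sum: "dact X Y (\<Sum>i\<in>I. \<phi> i) = (\<Sum>i\<in>I. dact X Y (\<phi> i))"
proof -
  have "dact X Y 0 = 0" by (simp add: vec_eq_iff dact_def)
  then show ?thesis by (induction I rule: infinite_finite_induct) (simp_all add: dact_add)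
qed

lemma dact_wedge_tensor:
  "dact X Y (wedge_tensor v v' w) =
    wedge_tensor (X *v v) v' w + wedge_tensor v (X *v v') w + wedge_tensor v v' (Y *v w)"
  by (simp add: vec_eq_iff dact_def wedge_tensor_def matrix_vector_mult_def sum_distrib_left
      sum_distrib_right sum_subtractf algebra_simps)

text \<open>The image of the differential of \<open>(A, B, p) \<mapsto> act (A, B) (hesse p)\<close>
  at the identity and \<open>p\<close>.\<close>

definition tangent :: "'k::field ^ 2 \<Rightarrow> ('k ^ 5 ^ 5 ^ 5) set"
  where "tangent p = {dact X Y (hesse p) + hesse q | X Y q. True}"

lemma dact_in_tangent:
  fixes p :: "'k::field ^ 2"
  shows "dact X Y (hesse p) \<in> tangent p"
proof -
  have "hesse 0 = (0 :: 'k ^ 5 ^ 5 ^ 5)" by (simp add: vec_eq_iff hesse_def)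
  then show ?thesis unfolding tangent_def by (metis (mono_tags, lifting) add_0_right mem_Collect_eq)
qed

lemma hesse_in_tangent: "hesse q \<in> tangent p"
proof -
  have "dact 0 0 (hesse p) = 0" by (simp add: vec_eq_iff dact_def)
  then show ?thesis unfolding tangent_def by (metis (mono_tags, lifting) add_0_left mem_Collect_eq)
qed

lemma tangent_add:
  assumes "\<phi> \<in> tangent p" "\<psi> \<in> tangent p" shows "\<phi> + \<psi> \<in> tangent p"
proof -
  obtain X Y q X' Y' q' where
    "\<phi> = dact X Y (hesse p) + hesse q" "\<psi> = dact X' Y' (hesse p) + hesse q'"
    using assms unfolding tangent_def by blast
  then have "\<phi> + \<psi> = dact (X + X') (Y + Y') (hesse p) + hesse (q + q')"
    by (simp add: hesse_add vec_eq_iff dact_def sum.distrib algebra_simps)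
  then show ?thesis unfolding tangent_def by blast
qed

lemma tangent_scale:
  assumes "\<phi> \<in> tangent p" shows "tensor_scale c \<phi> \<in> tangent p"
proof -
  obtain X Y q where "\<phi> = dact X Y (hesse p) + hesse q"
    using assms unfolding tangent_def by blast
  then have "tensor_scale c \<phi> = dact (\<chi> i j. c * X$i$j) (\<chi> i j. c * Y$i$j) (hesse p) + hesse (c *s q)"
    by (simp add: hesse_scale vec_eq_iff dact_def sum_distrib_left algebra_simps)
  then show ?thesis unfolding tangent_def by blast
qed

lemma tangent_0: "0 \<in> tangent p"
proof -
  have "tensor_scale 0 (hesse 0) = 0" by (simp add: vec_eq_iff)
  then show ?thesis using tangent_scale[OF hesse_in_tangent] by metis
qed

lemma tangent_sum: "(\<And>i. i \<in> I \<Longrightarrow> \<phi> i \<in> tangent p) \<Longrightarrow> (\<Sum>i\<in>I. \<phi> i) \<in> tangent p"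
  by (induction I rule: infinite_finite_induct) (simp_all add: tangent_add tangent_0)

section \<open>Relations in the tangent space coming from matrix units\<close>

definition basis_tensor :: "5 \<Rightarrow> 5 \<Rightarrow> 5 \<Rightarrow> 'k::field ^ 5 ^ 5 ^ 5"
  where "basis_tensor i j k = wedge_tensor (axis i 1) (axis j 1) (axis k 1)"

lemma basis_tensor_skew: "basis_tensor j i k = tensor_scale (- 1) (basis_tensor i j k)"
  and basis_tensor_diag: "basis_tensor i i k = 0"
  by (simp_all add: vec_eq_iff basis_tensor_def wedge_tensor_def left_diff_distrib)

definition unit_matrix :: "5 \<Rightarrow> 5 \<Rightarrow> 'k::field ^ 5 ^ 5"
  where "unit_matrix j i = (\<chi> a b. if a = j \<and> b = i then 1 else 0)"

lemma unit_matrix_axis: "unit_matrix j i *v axis m 1 = (if m = i then axis j 1 else 0)"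
proof -
  have "(unit_matrix j i *v axis m 1) $ a = (if m = i then axis j 1 else (0 :: 'a ^ 5)) $ a" for a
    unfolding matrix_nth_axis[symmetric] by (simp add: unit_matrix_def axis_def)
  then show ?thesis by (simp add: vec_eq_iff)
qed

lemma dact_basis_tensor_V:
  "dact (unit_matrix j i) 0 (basis_tensor u v m) =
    (if u = i then basis_tensor j v m else 0) + (if v = i then basis_tensor u j m else 0)"
proof -
  have "wedge_tensor 0 x y = 0" "wedge_tensor x 0 y = 0" "wedge_tensor x y 0 = 0"
    for x y :: "'a ^ 5"
    by (simp_all add: vec_eq_iff wedge_tensor_def)
  then show ?thesis unfolding basis_tensor_def dact_wedge_tensor unit_matrix_axis by simp
qed

lemma dact_basis_tensor_W:
  "dact 0 (unit_matrix l k) (basis_tensor u v m) = (if m = k then basis_tensor u v l else 0)"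
proof -
  have "wedge_tensor 0 x y = 0" "wedge_tensor x 0 y = 0" "wedge_tensor x y 0 = 0"
    for x y :: "'a ^ 5"
    by (simp_all add: vec_eq_iff wedge_tensor_def)
  then show ?thesis unfolding basis_tensor_def dact_wedge_tensor unit_matrix_axis by simp
qed

lemma hesse_basis_tensor:
  "hesse p = tensor_scale (p$1) (\<Sum>m\<in>UNIV. basis_tensor (1 + m) (4 + m) m) +
    tensor_scale (p$2) (\<Sum>m\<in>UNIV. basis_tensor (2 + m) (3 + m) m)"
  unfolding hesse_eq basis_tensor_def ..

text \<open>The matrix unit taking the \<open>i\<close>-th to the \<open>j\<close>-th basis vector
  of \<open>V\<close> touches the four summands of the Hesse tensor that contain index
  \<open>i\<close>.\<close>

lemma tangent_V:
  "tensor_scale (p$1) (basis_tensor j (i + 3) (i + 4) + basis_tensor (i + 2) j (i + 1)) +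
    tensor_scale (p$2) (basis_tensor j (i + 1) (i + 3) + basis_tensor (i + 4) j (i + 2)) \<in> tangent p"
proof -
  have sum: "(\<Sum>m\<in>UNIV. if u + m = i then f m else 0) = (f (i - u) :: 'a ^ 5 ^ 5 ^ 5)" for u and f :: "5 \<Rightarrow> _"
  proof -
    have "(\<Sum>m\<in>UNIV. if u + m = i then f m else 0) = (\<Sum>m\<in>UNIV. if m = i - u then f m else 0)"
      by (intro sum.cong refl if_cong) (auto simp: algebra_simps)
    then show ?thesis by simp
  qed
  have "dact (unit_matrix j i) 0 (\<Sum>m\<in>UNIV. basis_tensor (u + m) (v + m) m) =
      (basis_tensor j (v + (i - u)) (i - u) + basis_tensor (u + (i - v)) j (i - v) :: 'a ^ 5 ^ 5 ^ 5)" for u v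
    unfolding dact_sum dact_basis_tensor_V sum.distrib sum ..
  moreover have "i - 1 = i + 4" "i - 4 = i + 1" "i - 2 = i + 3" "i - 3 = i + 2"
    "4 + (i + 4) = i + 3" "1 + (i + 1) = i + 2" "3 + (i + 3) = i + 1" "2 + (i + 2) = i + 4"
    by simp_all
  ultimately have "dact (unit_matrix j i) 0 (hesse p) =
    tensor_scale (p$1) (basis_tensor j (i + 3) (i + 4) + basis_tensor (i + 2) j (i + 1)) +
    tensor_scale (p$2) (basis_tensor j (i + 1) (i + 3) + basis_tensor (i + 4) j (i + 2))"
    unfolding hesse_basis_tensor dact_add dact_scale by (simp only:)
  then show ?thesis using dact_in_tangent by metis
qed

text \<open>A matrix unit on \<open>W\<close> picks the single summand with index \<open>k\<close>
  from each half of the family.\<close>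

lemma tangent_W:
  "tensor_scale (p$1) (basis_tensor (k + 1) (k + 4) l) + tensor_scale (p$2) (basis_tensor (k + 2) (k + 3) l)
    \<in> tangent p"
proof -
  have "dact 0 (unit_matrix l k) (hesse p) =
    tensor_scale (p$1) (basis_tensor (1 + k) (4 + k) l) + tensor_scale (p$2) (basis_tensor (2 + k) (3 + k) l)"
    unfolding hesse_basis_tensor dact_add dact_scale dact_sum dact_basis_tensor_W by simp
  then show ?thesis using dact_in_tangent by (metis add.commute)
qed

text \<open>Modulo the tangent space, \<open>v\<^sub>c\<^sub>+\<^sub>2 \<and> v\<^sub>c\<^sub>-\<^sub>2\<close> is a multiple of \<open>v\<^sub>c\<^sub>+\<^sub>1 \<and> v\<^sub>c\<^sub>-\<^sub>1\<close>; the matrix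
  units \<open>v\<^sub>i \<mapsto> v\<^sub>i\<^sub>+\<^sub>s\<close> then give a circulant system with step \<open>r = 1/s\<close>.\<close>

lemma basis_tensor_in_tangent_weight:
  fixes a :: "'k::field"
  assumes p: "p$1 = a" "p$2 = 1" and nz: "1 + 11 * a ^ 5 - a ^ 10 \<noteq> 0" and l: "l \<noteq> 0"
  shows "basis_tensor (c + 1) (c + 4) (c + l) \<in> tangent p"
proof -
  let ?W = "basis_tensor :: 5 \<Rightarrow> 5 \<Rightarrow> 5 \<Rightarrow> 'k ^ 5 ^ 5 ^ 5"
  define e where "e c = ?W (c + 1) (c + 4) (c + l)" for c
  have V: "tensor_scale a (?W j x3 x4 + ?W x2 j x1) + (?W j x1 x3 + ?W x4 j x2) \<in> tangent p"
    if "x1 = i + 1" "x2 = i + 2" "x3 = i + 3" "x4 = i + 4" for x1 i x2 x3 x4 j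
    using tangent_V[of p j i] unfolding p that by simp
  have W: "tensor_scale a (?W x1 x4 m) + ?W x2 x3 m \<in> tangent p"
    if "x1 = k + 1" "x2 = k + 2" "x3 = k + 3" "x4 = k + 4" for x1 k x2 x3 x4 m
    using tangent_W[of p k m] unfolding p that by simp
  have skew: "?W j i k $ x $ y $ z = - ?W i j k $ x $ y $ z" and diag: "?W i i k = 0" for i j k x y z
    by (subst basis_tensor_skew, simp, simp add: basis_tensor_diag)
  have e_eq: "e c = ?W x1 x4 m" if "x1 = c + 1" "x4 = c + 4" "m = c + l" for c x1 x4 m
    unfolding e_def that ..
  \<comment> \<open>These are the rows of the circulant system. In each case one term of the
    \<open>V\<close> relation \<open>X\<close> vanishes by skew symmetry, and the \<open>W\<close>
    relations \<open>Y1\<close>, \<open>Y2\<close> trade indices \<open>k + 2, k + 3\<close> for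
    \<open>k + 1, k + 4\<close>.\<close>
  have mem: "e i + tensor_scale a (e (i + 2 * r)) + tensor_scale (- (a ^ 2)) (e (i + 4 * r)) \<in> tangent p"
    if rl: "r * l = 2" for r i
  proof -
    consider "l = 2" "r = 1" | "l = 4" "r = 3" | "l = 1" "r = 2" | "l = 3" "r = 4"
      using rl l by (cases l rule: five_cases; cases r rule: five_cases; simp)
    then show ?thesis
    proof cases
      case 1
      have E: "e i = ?W (i + 1) (i + 4) (i + 2)" "e (i + 2 * r) = ?W (i + 3) (i + 1) (i + 4)" "e (i + 4 * r) = ?W i (i + 3) (i + 1)"
        by (rule e_eq; simp add: 1)+
      have X: "tensor_scale a (?W (i + 1) (i + 3) (i + 4) + ?W (i + 2) (i + 1) (i + 1)) +
          (?W (i + 1) (i + 1) (i + 3) + ?W (i + 4) (i + 1) (i + 2)) \<in> tangent p"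
        by (rule V[of _ "i"]) simp_all
      have Y1: "tensor_scale a (?W i (i + 3) (i + 1)) + ?W (i + 1) (i + 2) (i + 1) \<in> tangent p"
        by (rule W[of _ "i + 4"]) simp_all
      \<comment> \<open>The factor \<open>- 1\<close> appears because \<open>X\<close> contains
        \<open>e i\<close> with its two \<open>V\<close> indices exchanged.\<close>
      from tangent_add[OF tangent_scale[OF X, of "- 1"] tangent_scale[OF Y1, of "- a"]]
      show ?thesis
        by (rule back_subst)
          (simp add: vec_eq_iff E skew[of "i + 1"] diag ring_distribs power2_eq_square mult.assoc)
    next
      case 2
      have E: "e i = ?W (i + 1) (i + 4) (i + 4)" "e (i + 2 * r) = ?W (i + 2) i i" "e (i + 4 * r) = ?W (i + 3) (i + 1) (i + 1)"
        by (rule e_eq; simp add: 2)+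
      have X: "tensor_scale a (?W (i + 4) i (i + 1) + ?W (i + 4) (i + 4) (i + 3)) +
          (?W (i + 4) (i + 3) i + ?W (i + 1) (i + 4) (i + 4)) \<in> tangent p"
        by (rule V[of _ "i + 2"]) simp_all
      have Y1: "tensor_scale a (?W (i + 3) (i + 1) (i + 1)) + ?W (i + 4) i (i + 1) \<in> tangent p"
        by (rule W[of _ "i + 2"]) simp_all
      have Y2: "tensor_scale a (?W (i + 2) i i) + ?W (i + 3) (i + 4) i \<in> tangent p"
        by (rule W[of _ "i + 1"]) simp_all
      from tangent_add[OF tangent_add[OF X tangent_scale[OF Y1, of "- a"]] Y2]
      show ?thesis
        by (rule back_subst)
          (simp add: vec_eq_iff E skew[of "i + 4" "i + 3"] diag ring_distribs power2_eq_square mult.assoc)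
    next
      case 3
      have E: "e i = ?W (i + 1) (i + 4) (i + 1)" "e (i + 2 * r) = ?W i (i + 3) i" "e (i + 4 * r) = ?W (i + 4) (i + 2) (i + 4)"
        by (rule e_eq; simp add: 3)+
      have X: "tensor_scale a (?W (i + 1) (i + 1) (i + 2) + ?W i (i + 1) (i + 4)) +
          (?W (i + 1) (i + 4) (i + 1) + ?W (i + 2) (i + 1) i) \<in> tangent p"
        by (rule V[of _ "i + 3"]) simp_all
      have Y1: "tensor_scale a (?W (i + 4) (i + 2) (i + 4)) + ?W i (i + 1) (i + 4) \<in> tangent p"
        by (rule W[of _ "i + 3"]) simp_all
      have Y2: "tensor_scale a (?W i (i + 3) i) + ?W (i + 1) (i + 2) i \<in> tangent p"
        by (rule W[of _ "i + 4"]) simp_all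
      from tangent_add[OF tangent_add[OF X tangent_scale[OF Y1, of "- a"]] Y2]
      show ?thesis
        by (rule back_subst)
          (simp add: vec_eq_iff E skew[of "i + 2" "i + 1"] diag ring_distribs power2_eq_square mult.assoc)
    next
      case 4
      have E: "e i = ?W (i + 1) (i + 4) (i + 3)" "e (i + 2 * r) = ?W (i + 4) (i + 2) (i + 1)" "e (i + 4 * r) = ?W (i + 2) i (i + 4)"
        by (rule e_eq; simp add: 4)+
      have X: "tensor_scale a (?W (i + 4) (i + 3) (i + 4) + ?W (i + 2) (i + 4) (i + 1)) +
          (?W (i + 4) (i + 1) (i + 3) + ?W (i + 4) (i + 4) (i + 2)) \<in> tangent p"
        by (rule V[of _ "i"]) simp_all
      have Y1: "tensor_scale a (?W (i + 2) i (i + 4)) + ?W (i + 3) (i + 4) (i + 4) \<in> tangent p"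
        by (rule W[of _ "i + 1"]) simp_all
      from tangent_add[OF tangent_scale[OF X, of "- 1"] tangent_scale[OF Y1, of "- a"]]
      show ?thesis
        by (rule back_subst)
          (simp add: vec_eq_iff E skew[of "i + 4"] diag ring_distribs power2_eq_square mult.assoc)
    qed
  qed
  obtain r where r: "r * l = 2"
  proof -
    obtain u where "u * l = 1" using five_inverse[OF l] .
    then have "(2 * u) * l = 2" by (simp only: mult.assoc) simp
    then show ?thesis by (rule that)
  qed
  define g where "g i = e i + tensor_scale a (e (i + 2 * r)) + tensor_scale (- (a ^ 2)) (e (i + 4 * r))" for i
  have g: "g i \<in> tangent p" for i unfolding g_def by (rule mem[OF r])
  \<comment> \<open>Applying the adjugate coordinatewise isolates \<open>e c\<close> up to the
    discriminant, which is then divided out.\<close>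
  have "tensor_scale (1 + 11 * a ^ 5 - a ^ 10) (e c) =
      tensor_scale (1 + 3 * a ^ 5) (g c) + tensor_scale ((2 * a ^ 5 - 1) * a) (g (c + 2 * r))
      + tensor_scale ((2 + a ^ 5) * a ^ 2) (g (c + 4 * r)) + tensor_scale ((a ^ 5 - 3) * a ^ 3) (g (c + r))
      + tensor_scale (5 * a ^ 4) (g (c + 3 * r))" (is "_ = ?R")
  proof -
    have "?R $ x $ y $ z = (1 + 11 * a ^ 5 - a ^ 10) * e c $ x $ y $ z" for x y z
      unfolding circulant_solve[of a "\<lambda>c. e c $ x $ y $ z" c r, symmetric] by (simp add: g_def)
    then show ?thesis by (simp add: vec_eq_iff)
  qed
  then have "tensor_scale (1 + 11 * a ^ 5 - a ^ 10) (e c) \<in> tangent p"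
    using g by (simp add: tangent_add tangent_scale)
  then have "tensor_scale (1 / (1 + 11 * a ^ 5 - a ^ 10)) (tensor_scale (1 + 11 * a ^ 5 - a ^ 10) (e c)) \<in> tangent p"
    by (rule tangent_scale)
  moreover have "tensor_scale (1 / d) (tensor_scale d \<phi>) = \<phi>" if "d \<noteq> 0" for d :: 'k and \<phi>
    using that by (simp add: vec_eq_iff)
  ultimately show ?thesis using nz by (simp add: e_def)
qed

text \<open>For the invariant weight the circulant is \<open>a U\<close> with \<open>U = T + T\<^sup>4 - T\<^sup>2 - T\<^sup>3\<close>, and
  \<open>U\<^sup>2 = 5 - (1 + T + T\<^sup>2 + T\<^sup>3 + T\<^sup>4)\<close>.\<close>

lemma basis_tensor_in_tangent_0:
  fixes a :: "'k::field"
  assumes p: "p$1 = a" "p$2 = 1" and "a \<noteq> 0" "(5 :: 'k) \<noteq> 0"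
  shows "basis_tensor (c + 1) (c + 4) c \<in> tangent p"
proof -
  let ?W = "basis_tensor :: 5 \<Rightarrow> 5 \<Rightarrow> 5 \<Rightarrow> 'k ^ 5 ^ 5 ^ 5"
  define e where "e c = ?W (c + 1) (c + 4) c" for c
  define u where "u i = e (i + 4) + e (i + 1) - e (i + 2) - e (i + 3)" for i
  have V: "tensor_scale a (?W j x3 x4 + ?W x2 j x1) + (?W j x1 x3 + ?W x4 j x2) \<in> tangent p"
    if "x1 = i + 1" "x2 = i + 2" "x3 = i + 3" "x4 = i + 4" for x1 i x2 x3 x4 j
    using tangent_V[of p j i] unfolding p that by simp
  have W: "tensor_scale a (?W x1 x4 m) + ?W x2 x3 m \<in> tangent p"
    if "x1 = k + 1" "x2 = k + 2" "x3 = k + 3" "x4 = k + 4" for x1 k x2 x3 x4 m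
    using tangent_W[of p k m] unfolding p that by simp
  have e_eq: "e c = ?W x1 x4 c" if "x1 = c + 1" "x4 = c + 4" for c x1 x4
    unfolding e_def that ..
  have inv: "\<phi> \<in> tangent p" if "tensor_scale d \<phi> \<in> tangent p" "d \<noteq> 0" for d \<phi>
  proof -
    have "tensor_scale (1 / d) (tensor_scale d \<phi>) = \<phi>" using that(2) by (simp add: vec_eq_iff)
    then show ?thesis using tangent_scale[OF that(1), of "1 / d"] by simp
  qed
  have u: "u i \<in> tangent p" for i
  proof (rule inv[OF _ \<open>a \<noteq> 0\<close>])
    \<comment> \<open>The diagonal matrix unit at \<open>i\<close> gives \<open>X\<close>;
      subtracting the two \<open>W\<close> relations leaves \<open>a\<close> times
      \<open>u i\<close>.\<close>
    have X: "tensor_scale a (?W i (i + 3) (i + 4) + ?W (i + 2) i (i + 1)) +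
        (?W i (i + 1) (i + 3) + ?W (i + 4) i (i + 2)) \<in> tangent p"
      by (rule V[of _ "i"]) simp_all
    have Y1: "tensor_scale a (?W (i + 4) (i + 2) (i + 3)) + ?W i (i + 1) (i + 3) \<in> tangent p"
      by (rule W[of _ "i + 3"]) simp_all
    have Y2: "tensor_scale a (?W (i + 3) (i + 1) (i + 2)) + ?W (i + 4) i (i + 2) \<in> tangent p"
      by (rule W[of _ "i + 2"]) simp_all
    have E: "e (i + 1) = ?W (i + 2) i (i + 1)" "e (i + 2) = ?W (i + 3) (i + 1) (i + 2)"
      "e (i + 3) = ?W (i + 4) (i + 2) (i + 3)" "e (i + 4) = ?W i (i + 3) (i + 4)"
      by (rule e_eq; simp)+
    from tangent_add[OF X tangent_scale[OF tangent_add[OF Y1 Y2], of "- 1"]]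
    show "tensor_scale a (u i) \<in> tangent p"
      by (rule back_subst) (simp add: vec_eq_iff u_def E ring_distribs)
  qed
  have UNIV_5: "(UNIV :: 5 set) = {c, c + 1, c + 2, c + 3, c + 4}"
  proof -
    have "x \<in> {c, c + 1, c + 2, c + 3, c + 4}" for x
      by (cases c rule: five_cases; cases x rule: five_cases; simp)
    then show ?thesis by blast
  qed
  have sum: "(\<Sum>m\<in>UNIV. f m) = f c + f (c + 1) + f (c + 2) + f (c + 3) + f (c + 4)" for f :: "5 \<Rightarrow> 'k ^ 5 ^ 5 ^ 5"
    unfolding UNIV_5 by (simp add: add.assoc)
  have em: "?W (1 + m) (4 + m) m = e m" for m
    unfolding e_def add.commute[of m 1] add.commute[of m 4] ..
  \<comment> \<open>The operator \<open>U\<close> annihilates the sum of all \<open>e m\<close>;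
    that direction is obtained by moving the parameter of the Hesse family.\<close>
  have "hesse (\<chi> i. if i = 1 then 1 else 0) = (\<Sum>m\<in>UNIV. e m)"
    unfolding hesse_basis_tensor by (simp add: vec_eq_iff em)
  then have s: "(\<Sum>m\<in>UNIV. e m) \<in> tangent p" using hesse_in_tangent by metis
  have idx: "c + 1 + 1 = c + 2" "c + 1 + 2 = c + 3" "c + 1 + 3 = c + 4" "c + 1 + 4 = c"
    "c + 2 + 1 = c + 3" "c + 2 + 2 = c + 4" "c + 2 + 3 = c" "c + 2 + 4 = c + 1"
    "c + 3 + 1 = c + 4" "c + 3 + 2 = c" "c + 3 + 3 = c + 1" "c + 3 + 4 = c + 2"
    "c + 4 + 1 = c" "c + 4 + 2 = c + 1" "c + 4 + 3 = c + 2" "c + 4 + 4 = c + 3"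
    by simp_all
  have "tensor_scale 5 (e c) = u (c + 1) + u (c + 4) + tensor_scale (- 1) (u (c + 2) + u (c + 3)) + (\<Sum>m\<in>UNIV. e m)"
    unfolding sum u_def idx by (simp add: vec_eq_iff)
  then have "tensor_scale 5 (e c) \<in> tangent p"
    using u s by (simp add: tangent_add tangent_scale)
  from inv[OF this \<open>5 \<noteq> 0\<close>] show ?thesis by (simp add: e_def)
qed

text \<open>Two distinct indices are, up to order, \<open>c + 1, c + 4\<close> or
  \<open>c + 2, c + 3\<close>. The first kind is settled weight by weight with
  \<open>l = k - c\<close>, and the second reduces to it by \<open>tangent_W\<close>.\<close>

lemma tangent_eq_wedge2V_W:
  fixes a :: "'k::field"
  assumes p: "p$1 = a" "p$2 = 1" and "a \<noteq> 0" "1 + 11 * a ^ 5 - a ^ 10 \<noteq> 0" "(5 :: 'k) \<noteq> 0"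
    and \<phi>: "\<phi> \<in> wedge2V_W"
  shows "\<phi> \<in> tangent p"
proof -
  let ?W = "basis_tensor :: 5 \<Rightarrow> 5 \<Rightarrow> 5 \<Rightarrow> 'k ^ 5 ^ 5 ^ 5"
  have W1: "?W x1 x4 k \<in> tangent p" if "x1 = c + 1" "x4 = c + 4" for x1 c x4 k
  proof (cases "k = c")
    case True
    then show ?thesis unfolding that using basis_tensor_in_tangent_0[OF p assms(3,5)] by simp
  next
    case False
    then show ?thesis
      unfolding that using basis_tensor_in_tangent_weight[OF p assms(4), of "k - c" c] by simp
  qed
  have W2: "?W x2 x3 k \<in> tangent p" if "x2 = c + 2" "x3 = c + 3" for x2 c x3 k
  proof -
    have "tensor_scale a (?W (c + 1) (c + 4) k) + ?W (c + 2) (c + 3) k \<in> tangent p"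
      using tangent_W[of p c k] unfolding p by simp
    from tangent_add[OF tangent_scale[OF W1[OF refl refl, of c k], of "- a"] this]
    show ?thesis unfolding that by (rule back_subst) (simp add: vec_eq_iff)
  qed
  have skew: "?W j i k \<in> tangent p" if "?W i j k \<in> tangent p" for i j k
    using tangent_scale[OF that, of "- 1"] unfolding basis_tensor_skew[of j i k] .
  have W: "?W i j k \<in> tangent p" for i j k
  proof -
    have j: "j = i + (j - i)" by simp
    show ?thesis
    proof (cases "j - i" rule: five_cases)
      case 1
      then show ?thesis by (simp add: basis_tensor_diag tangent_0)
    next
      case 2
      then have "j = i + 1" using j by simp
      show ?thesis by (rule W2[of _ "i + 3"]) (simp_all add: \<open>j = i + 1\<close>)
    next
      case 3
      then have "j = i + 2" using j by simp
      show ?thesis by (rule skew, rule W1[of _ "i + 1"]) (simp_all add: \<open>j = i + 2\<close>)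
    next
      case 4
      then have "j = i + 3" using j by simp
      show ?thesis by (rule W1[of _ "i + 4"]) (simp_all add: \<open>j = i + 3\<close>)
    next
      case 5
      then have "j = i + 4" using j by simp
      show ?thesis by (rule skew, rule W2[of _ "i + 2"]) (simp_all add: \<open>j = i + 4\<close>)
    qed
  qed
  have "wedge_tensor (axis i c) (axis j 1) (axis k 1) \<in> tangent p" for i j k and c :: 'k
    using tangent_scale[OF W[of i j k], of c] by (subst wedge_tensor_axis) (simp add: basis_tensor_def)
  then show ?thesis
    by (subst wedge2V_W_decomposition[OF \<phi>]) (intro tangent_sum)
qed

section \<open>Density and the main theorem\<close>

lemma act_rescale:
  assumes "a \<noteq> 0" "b \<noteq> 0"
  shows "act (\<chi> i. (1 / a) *s A $ i, \<chi> i. (1 / b) *s B $ i) (tensor_scale (a * a * b) \<phi>) = act (A, B) \<phi>"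
proof -
  have "act (\<chi> i. (1 / a) *s A $ i, \<chi> i. (1 / b) *s B $ i) (tensor_scale (a * a * b) \<phi>) $ i $ j $ k =
      act (A, B) \<phi> $ i $ j $ k" for i j k
    unfolding act_def vec_lambda_beta by (intro sum.cong refl) (use assms in simp)
  then show ?thesis by (simp add: vec_eq_iff)
qed

lemma det_rescale:
  fixes A :: "'k::field ^ 5 ^ 5"
  assumes "a ^ 5 = det A" "det A \<noteq> 0"
  shows "det (\<chi> i. (1 / a) *s A $ i) = 1"
  using assms det_rows_mul[of "\<lambda>_. 1 / a" "\<lambda>i. A $ i"] by (simp add: power_one_over)

text \<open>Dividing by fifth roots \<open>a\<close>, \<open>b\<close> of the determinants lands in
  \<open>SL\<close>, and the leftover scalar \<open>a * a * b\<close> is absorbed into the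
  parameter, as the Hesse family is linear.\<close>

lemma covariant_eq_on_GL_orbit:
  fixes smul :: "'k::alg_closed_field \<Rightarrow> 'y::ab_group_add \<Rightarrow> 'y"
  assumes F: "covariant smul \<rho> F" and F': "covariant smul \<rho> F'" and eq: "F' \<circ> hesse = F \<circ> hesse"
    and det: "det A \<noteq> 0" "det B \<noteq> 0"
  shows "F' (act (A, B) (hesse p)) = F (act (A, B) (hesse p))"
proof -
  obtain a b where ab: "a ^ 5 = det A" "b ^ 5 = det B"
    using nth_root_exists[of 5] by (metis zero_less_numeral)
  then have nz: "a \<noteq> 0" "b \<noteq> 0" using det by (metis zero_power zero_less_numeral)+
  define g where "g = (\<chi> i. (1 / a) *s A $ i, \<chi> i. (1 / b) *s B $ i)"
  have g: "g \<in> carrier (SL \<times>\<times> SL)"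
    using det_rescale[OF ab(1) det(1)] det_rescale[OF ab(2) det(2)] by (simp add: g_def SL_def)
  have "act (A, B) (hesse p) = act g (hesse ((a * a * b) *s p))"
    unfolding hesse_scale g_def act_rescale[OF nz] ..
  moreover have "F' (act g \<phi>) = \<rho> g (F' \<phi>)" "F (act g \<phi>) = \<rho> g (F \<phi>)" if "\<phi> \<in> wedge2V_W" for \<phi>
    using F F' g that unfolding covariant_def by blast+
  ultimately show ?thesis using fun_cong[OF eq] by (simp add: hesse_in_wedge2V_W)
qed

lemma poly_fun_det:
  assumes "\<And>i j. poly_fun 0 (\<lambda>s. A s $ i $ j)" shows "poly_fun 0 (\<lambda>s. det (A s))"
  unfolding det_def
  by (intro poly_fun_sum poly_fun_mult[of 0 _ 0, simplified] poly_fun_const poly_fun_prod assms)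

lemma poly_fun_act:
  assumes "\<And>i j. poly_fun 0 (\<lambda>s. A s $ i $ j)" "\<And>i j. poly_fun 0 (\<lambda>s. B s $ i $ j)"
    "\<And>i j k. poly_fun 0 (\<lambda>s. \<phi> s $ i $ j $ k)"
  shows "poly_fun 0 (\<lambda>s. act (A s, B s) (\<phi> s) $ i $ j $ k)"
  unfolding act_def vec_lambda_beta fst_conv snd_conv
  by (intro poly_fun_sum poly_fun_mult[of 0 _ 0, simplified] assms)

text \<open>The product of both expressions has linear coefficient 1, so it is a nonzero polynomial
  in every characteristic.\<close>

lemma hesse_regular_parameter:
  obtains a :: "'k::alg_closed_field" where "a \<noteq> 0" "1 + 11 * a ^ 5 - a ^ 10 \<noteq> 0"
proof -
  define q :: "'k poly" where "q = monom 1 1 * ([:1:] + monom 11 5 - monom 1 10)"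
  have "coeff q 1 = 1" by (simp add: q_def coeff_monom_mult)
  then have "q \<noteq> 0" by auto
  then obtain a where "poly q a \<noteq> 0"
    using poly_roots_finite[of q] infinite_UNIV_alg_closed by (metis (mono_tags) UNIV_eq_I mem_Collect_eq)
  then show ?thesis by (intro that[of a]) (auto simp: q_def poly_monom)
qed

text \<open>Density of the orbit: on the line \<open>c\<close> from \<open>hesse p0\<close> to
  \<open>\<phi>\<close>, \<open>P\<close> is congruent modulo every power of \<open>s\<close> to its
  values along an arc in the orbit, which are 0.\<close>

lemma fun_algebra_eq_0_on_wedge2V_W:
  fixes P :: "'k::alg_closed_field ^ 5 ^ 5 ^ 5 \<Rightarrow> 'k"
  assumes P: "P \<in> fun_algebra tensor_coords" and five: "(5 :: 'k) \<noteq> 0"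
    and orbit: "\<And>A B p. det A \<noteq> 0 \<Longrightarrow> det B \<noteq> 0 \<Longrightarrow> P (act (A, B) (hesse p)) = 0"
    and \<phi>: "\<phi> \<in> wedge2V_W"
  shows "P \<phi> = 0"
proof -
  obtain a :: 'k where a: "a \<noteq> 0" "1 + 11 * a ^ 5 - a ^ 10 \<noteq> 0"
    using hesse_regular_parameter .
  define p0 :: "'k ^ 2" where "p0 = (\<chi> i. if i = 1 then a else 1)"
  have surj: "\<exists>X Y q. dact X Y (hesse p0) + hesse q = y" if "y \<in> wedge2V_W" for y
    using tangent_eq_wedge2V_W[of p0 a, OF _ _ a five that] by (auto simp: tangent_def p0_def)
  define y where "y = \<phi> - hesse p0"
  have y: "y \<in> wedge2V_W" unfolding y_def by (intro wedge2V_W_diff \<phi> hesse_in_wedge2V_W)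
  define c where "c s = hesse p0 + tensor_scale s y" for s
  have c0: "poly_fun 0 (\<lambda>s. q (c s))" if "q \<in> tensor_coords" for q
  proof -
    have "poly_fun 0 (\<lambda>s. hesse p0 $ i $ j $ k + s ^ 1 * y $ i $ j $ k)" for i j k
      by (intro poly_fun_add poly_fun_const poly_fun_mono[OF poly_fun_power]) simp
    then show ?thesis using that by (auto simp: tensor_coords_def c_def)
  qed
  have "poly_fun N (\<lambda>s. P (c s))" for N
  proof -
    obtain A B p where A: "\<And>i j. poly_fun 0 (\<lambda>s. A s $ i $ j)" "A 0 = mat 1"
      and B: "\<And>i j. poly_fun 0 (\<lambda>s. B s $ i $ j)" "B 0 = mat 1"
      and p: "\<And>i. poly_fun 0 (\<lambda>s. p s $ i)"
      and err: "\<And>i j k. poly_fun (Suc N)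
        (\<lambda>s. (act (A s, B s) (hesse (p s)) - hesse p0 - tensor_scale s y) $ i $ j $ k)"
      using hesse_newton[OF surj y, of N] by auto
    define c' where "c' s = act (A s, B s) (hesse (p s))" for s
    have "poly_fun 0 (\<lambda>s. hesse (p s) $ i $ j $ k)" for i j k
      unfolding hesse_nth by (intro poly_fun_add poly_fun_mult[of 0 _ 0, simplified] p poly_fun_const)
    then have "poly_fun 0 (\<lambda>s. c' s $ i $ j $ k)" for i j k
      unfolding c'_def by (intro poly_fun_act A B)
    then have c'0: "poly_fun 0 (\<lambda>s. q (c' s))" if "q \<in> tensor_coords" for q
      using that by (auto simp: tensor_coords_def)
    have "poly_fun (Suc N) (\<lambda>s. q (c' s) - q (c s))" if "q \<in> tensor_coords" for q
      using that err by (auto simp: tensor_coords_def c_def c'_def diff_diff_eq)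
    then have cong: "poly_fun (Suc N) (\<lambda>s. P (c' s) - P (c s))"
      by (intro fun_algebra_poly_fun_cong[OF P] c0 c'0)
    \<comment> \<open>The matrices of the arc may become singular, but their determinant is a
      polynomial with value 1 at 0, so only finitely many \<open>s\<close> are lost.\<close>
    have finite_det: "finite {s. det (M s) = 0}"
      if "\<And>i j. poly_fun 0 (\<lambda>s. M s $ i $ j)" "M 0 = mat 1" for M :: "'k \<Rightarrow> 'k ^ 5 ^ 5"
      using poly_fun_eq_0[OF poly_fun_det[of M], of 0] that by auto
    have "infinite (UNIV - ({s. det (A s) = 0} \<union> {s. det (B s) = 0}))"
      using finite_det[OF A] finite_det[OF B] infinite_UNIV_alg_closed
      by (intro Diff_infinite_finite) simp_all
    then have "infinite {s. P (c' s) = 0}"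
      unfolding c'_def by (rule infinite_super[rotated]) (blast intro: orbit)
    then have "P (c' s) = 0" for s
      using fun_algebra_poly_fun[OF P c'0] by (intro poly_fun_eq_0[of "\<lambda>s. P (c' s)"])
    then have "poly_fun (Suc N) (\<lambda>s. P (c s))" using poly_fun_minus[OF cong] by simp
    then show ?thesis by (rule poly_fun_mono) simp
  qed
  \<comment> \<open>The line reaches \<open>\<phi>\<close> at \<open>s = 1\<close>.\<close>
  then have "P (c 1) = 0" by (rule poly_fun_all_eq_0[OF infinite_UNIV_alg_closed])
  then show ?thesis by (simp add: c_def y_def)
qed

text \<open>Linear functionals on \<open>Y\<close> turn both covariants into polynomial functions
  whose difference vanishes on the orbit, and functionals separate points.\<close>

lemma covariant_determined_by_hesse:
  fixes smul :: "'k::alg_closed_field \<Rightarrow> 'y::ab_group_add \<Rightarrow> 'y"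
  assumes "finite_dimensional_vector_space smul B" and five: "(5 :: 'k) \<noteq> 0"
    and F: "covariant smul \<rho> F" and F': "covariant smul \<rho> F'" and eq: "F' \<circ> hesse = F \<circ> hesse"
    and \<phi>: "\<phi> \<in> wedge2V_W"
  shows "F' \<phi> = F \<phi>"
proof -
  interpret finite_dimensional_vector_space smul B by fact
  have functional: "l (F' \<phi>) = l (F \<phi>)" if l: "Vector_Spaces.linear smul (*) l" for l
  proof -
    obtain p p' where p: "p \<in> fun_algebra tensor_coords" "\<And>\<psi>. \<psi> \<in> wedge2V_W \<Longrightarrow> l (F \<psi>) = p \<psi>"
      and p': "p' \<in> fun_algebra tensor_coords" "\<And>\<psi>. \<psi> \<in> wedge2V_W \<Longrightarrow> l (F' \<psi>) = p' \<psi>"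
      using F F' l unfolding covariant_def regular_map_def by metis
    define P where "P \<psi> = p' \<psi> + (- 1) * p \<psi>" for \<psi>
    have "P \<in> fun_algebra tensor_coords"
      unfolding P_def by (intro fun_algebra_add fun_algebra_mult fun_algebra_const p p')
    moreover have "P (act (M, N) (hesse q)) = 0" if "det M \<noteq> 0" "det N \<noteq> 0" for M N q
    proof -
      \<comment> \<open>The polynomials \<open>p\<close> and \<open>p'\<close> represent the
        covariants only on \<open>wedge2V_W\<close>.\<close>
      have "act (M, N) (hesse q) \<in> wedge2V_W" by (intro act_in_wedge2V_W hesse_in_wedge2V_W)
      then show ?thesis
        using covariant_eq_on_GL_orbit[OF F F' eq that, of q] p(2) p'(2) by (metis P_def add.right_inverse mult_minus1)
    qed
    ultimately have "P \<phi> = 0" by (rule fun_algebra_eq_0_on_wedge2V_W[OF _ five _ \<phi>])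
    then show ?thesis using \<phi> by (simp add: P_def p p')
  qed
  \<comment> \<open>The functionals are specialised to the coordinates in the basis
    \<open>B\<close>.\<close>
  have "representation B (F' \<phi>) b = representation B (F \<phi>) b" for b
    by (rule functional[OF linear_representation[OF independent_Basis span_Basis]])
  then have "(\<Sum>b\<in>B. smul (representation B (F' \<phi>) b) b) = (\<Sum>b\<in>B. smul (representation B (F \<phi>) b) b)"
    by simp
  then show ?thesis
    by (simp add: sum_representation_eq[OF independent_Basis _ finite_Basis] span_Basis)
qed

section \<open>Restriction of regular maps to the Hesse plane\<close>

lemma fun_algebra_comp:
  assumes "P \<in> fun_algebra S" "\<And>q. q \<in> S \<Longrightarrow> (\<lambda>x. q (c x)) \<in> fun_algebra S'"
  shows "(\<lambda>x. P (c x)) \<in> fun_algebra S'"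
  using assms(1)
proof induction
  case (fun_algebra_mult p q)
  then show ?case by (intro fun_algebra.fun_algebra_mult)
next
  case (fun_algebra_add p q)
  then show ?case by (intro fun_algebra.fun_algebra_add)
qed (simp_all add: fun_algebra_const assms(2))

lemma regular_map_comp_hesse:
  assumes "regular_map wedge2V_W tensor_coords smul F"
  shows "regular_map UNIV plane_coords smul (F \<circ> hesse)"
  unfolding regular_map_def
proof (intro allI impI)
  fix l assume "Vector_Spaces.linear smul (*) l"
  then obtain P where P: "P \<in> fun_algebra tensor_coords" "\<And>\<phi>. \<phi> \<in> wedge2V_W \<Longrightarrow> l (F \<phi>) = P \<phi>"
    using assms unfolding regular_map_def by blast
  have "(\<lambda>p. hesse p $ i $ j $ k) \<in> fun_algebra plane_coords" for i j k
    unfolding hesse_nth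
    by (intro fun_algebra_add fun_algebra_mult fun_algebra_const fun_algebra_gen) (auto simp: plane_coords_def)
  then have "(\<lambda>p. P (hesse p)) \<in> fun_algebra plane_coords"
    by (intro fun_algebra_comp[OF P(1)]) (auto simp: tensor_coords_def)
  then show "\<exists>P\<in>fun_algebra plane_coords. \<forall>p\<in>UNIV. l ((F \<circ> hesse) p) = P p"
    using P(2)[OF hesse_in_wedge2V_W] by auto
qed

theorem theorem4p3:
  fixes z :: "'k::alg_closed_field"
    and smul :: "'k \<Rightarrow> 'y::ab_group_add \<Rightarrow> 'y"
    and B :: "'y set"
    and \<theta>V \<theta>W :: "h5 \<times> (5^2^2) \<Rightarrow> 'k ^ 5 ^ 5"
    and \<rho> :: "('k ^ 5 ^ 5) \<times> ('k ^ 5 ^ 5) \<Rightarrow> 'y \<Rightarrow> 'y"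
    and F :: "'k ^ 5 ^ 5 ^ 5 \<Rightarrow> 'y"
  assumes "CHAR('k) \<notin> {2, 3, 5}"
    and "z ^ 5 = 1" and "\<forall>n. 0 < n \<and> n < 5 \<longrightarrow> z ^ n \<noteq> 1"
    and "extends_theta_V z \<theta>V" and "extends_theta_W z \<theta>W"
    and "finite_dimensional_vector_space smul B"
    and "rational_rep smul \<rho>"
    and "covariant smul \<rho> F"
  shows "F ` range hesse \<subseteq> H5_fixed (theta \<theta>V \<theta>W \<rho>) \<and>
    discrete_covariant (chi1 \<theta>V \<theta>W) smul (H5_fixed (theta \<theta>V \<theta>W \<rho>))
      (\<lambda>\<gamma>. theta \<theta>V \<theta>W \<rho> (1, \<gamma>)) (F \<circ> hesse) \<and>
    (\<forall>F'. covariant smul \<rho> F' \<and> F' \<circ> hesse = F \<circ> hesse \<longrightarrow>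
      (\<forall>\<phi>\<in>wedge2V_W. F' \<phi> = F \<phi>))"
proof -
  interpret finite_dimensional_vector_space smul B by fact
  note \<theta> = assms(2-5)
  let ?\<theta> = "theta \<theta>V \<theta>W \<rho>"
  have GL: "(\<theta>V x, \<theta>W x) \<in> carrier (GL \<times>\<times> GL)" if "x \<in> carrier H5_plus" for x
    using \<theta>_hom[OF \<theta>] that by (simp add: GL_def hom_H5_plus_GL_invertible)
  have \<rho>: "linear_rep (GL \<times>\<times> GL) smul UNIV \<rho>" using assms(7) by (simp add: rational_rep_def)
  have \<theta>_add: "?\<theta> x (v + w) = ?\<theta> x v + ?\<theta> x w" and \<theta>_scale: "?\<theta> x (smul c v) = smul c (?\<theta> x v)"
    if "x \<in> carrier H5_plus" for x v w c
    using \<rho> GL[OF that] unfolding linear_rep_def theta_def by blast+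
  have \<theta>_mult: "?\<theta> (x \<otimes>\<^bsub>H5_plus\<^esub> y) v = ?\<theta> x (?\<theta> y v)"
    if "x \<in> carrier H5_plus" "y \<in> carrier H5_plus" for x y v
  proof -
    have "(\<theta>V (x \<otimes>\<^bsub>H5_plus\<^esub> y), \<theta>W (x \<otimes>\<^bsub>H5_plus\<^esub> y)) =
        (\<theta>V x, \<theta>W x) \<otimes>\<^bsub>GL \<times>\<times> GL\<^esub> (\<theta>V y, \<theta>W y)"
      using \<theta>_hom[OF \<theta>] that by (simp add: hom_H5_plus_GL_mult GL_def)
    then show ?thesis
      using \<rho> GL[OF that(1)] GL[OF that(2)] unfolding linear_rep_def theta_def by simp
  qed
  have \<theta>_one: "?\<theta> (1, mat 1) v = v" for v
  proof -
    have "(\<theta>V (1, mat 1), \<theta>W (1, mat 1)) = \<one>\<^bsub>GL \<times>\<times> GL\<^esub>"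
      using \<theta>_hom[OF \<theta>] by (simp add: hom_H5_plus_GL_one GL_def)
    then show ?thesis using \<rho> unfolding linear_rep_def theta_def by simp
  qed
  \<comment> \<open>As \<open>\<theta>V\<close> and \<open>\<theta>W\<close> have values in
    \<open>SL\<close>, equivariance under \<open>SL\<close> becomes equivariance under
    \<open>H5_plus\<close>.\<close>
  have covariant: "F (theta \<theta>V \<theta>W act x \<phi>) = ?\<theta> x (F \<phi>)"
    if "x \<in> carrier H5_plus" "\<phi> \<in> wedge2V_W" for x \<phi>
    using assms(8) \<theta>_SL[OF \<theta> that(1)] that(2) unfolding covariant_def theta_def by blast
  have fixed: "F (hesse p) \<in> H5_fixed ?\<theta>" for p
    unfolding H5_fixed_def
  proof (intro CollectI allI)
    fix h
    have "F (theta \<theta>V \<theta>W act (h, mat 1) (hesse p)) = ?\<theta> (h, mat 1) (F (hesse p))"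
      by (intro covariant hesse_in_wedge2V_W) (simp add: H5_plus_simps)
    then show "?\<theta> (h, mat 1) (F (hesse p)) = F (hesse p)"
      using hesse_in_H5_fixed[OF \<theta>, of p] by (simp add: H5_fixed_def)
  qed
  have H5: "(h, mat 1) \<in> carrier H5_plus" for h by (simp add: H5_plus_simps)
  have SL: "(1, \<gamma>) \<in> carrier H5_plus" if "\<gamma> \<in> carrier SL" for \<gamma> :: "5^2^2"
    using that by (simp add: H5_plus_simps SL_def)
  have "subspace (H5_fixed ?\<theta>)"
  proof (rule subspaceI)
    have "?\<theta> (h, mat 1) 0 = 0" for h using \<theta>_add[OF H5, of h 0 0] by simp
    then show "0 \<in> H5_fixed ?\<theta>" by (simp add: H5_fixed_def)
  qed (simp_all add: H5_fixed_def \<theta>_add[OF H5] \<theta>_scale[OF H5])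
  then have "linear_rep SL smul (H5_fixed ?\<theta>) (\<lambda>\<gamma>. ?\<theta> (1, \<gamma>))"
    unfolding linear_rep_def
  proof (intro conjI ballI allI)
    fix \<gamma> :: "5^2^2" and v assume "\<gamma> \<in> carrier SL" "v \<in> H5_fixed ?\<theta>"
    then show "?\<theta> (1, \<gamma>) v \<in> H5_fixed ?\<theta>" by (intro H5_fixed_stable \<theta>_mult)
  next
    fix \<gamma> \<gamma>' :: "5^2^2" and v assume "\<gamma> \<in> carrier SL" "\<gamma>' \<in> carrier SL"
    then show "?\<theta> (1, \<gamma> \<otimes>\<^bsub>SL\<^esub> \<gamma>') v = ?\<theta> (1, \<gamma>) (?\<theta> (1, \<gamma>') v)"
      using \<theta>_mult[OF SL SL, of \<gamma> \<gamma>' v] by (simp add: H5_plus_simps SL_def)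
  next
    show "?\<theta> (1, \<one>\<^bsub>SL\<^esub>) v = v" for v using \<theta>_one[of v] by (simp add: SL_def)
  qed (simp_all add: \<theta>_add[OF SL] \<theta>_scale[OF SL])
  moreover have "regular_map UNIV plane_coords smul (F \<circ> hesse)"
    using assms(8) by (intro regular_map_comp_hesse) (simp add: covariant_def)
  moreover have "(F \<circ> hesse) (chi1 \<theta>V \<theta>W \<gamma> *v p) = ?\<theta> (1, \<gamma>) ((F \<circ> hesse) p)"
    if "\<gamma> \<in> carrier SL" for \<gamma> :: "5^2^2" and p
    using chi1[OF \<theta> that, of p] covariant[OF SL[OF that] hesse_in_wedge2V_W, of p] by simp
  ultimately have "discrete_covariant (chi1 \<theta>V \<theta>W) smul (H5_fixed ?\<theta>) (\<lambda>\<gamma>. ?\<theta> (1, \<gamma>)) (F \<circ> hesse)"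
    unfolding discrete_covariant_def using fixed by auto
  \<comment> \<open>This is the 5 divided by for the invariant weight in the tangent
    computation.\<close>
  moreover have "(5 :: 'k) \<noteq> 0"
  proof
    assume "(5 :: 'k) = 0"
    then have "CHAR('k) dvd 5" using of_nat_eq_0_iff_char_dvd[of 5, where 'a = 'k] by simp
    moreover have "prime (5 :: nat)" by simp
    ultimately have "CHAR('k) = 1 \<or> CHAR('k) = 5" unfolding prime_nat_iff by blast
    then show False using assms(1) by simp
  qed
  ultimately show ?thesis
    using fixed covariant_determined_by_hesse[OF assms(6) _ assms(8)] by auto
qed

end
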